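(* Let $0<q<1$, $\sigma>0$, $0\le\gamma<2$, and assume that either $\gamma\in\{0,1\}$, or $\gamma\in(0,2)\setminus\{1\}$ and $q^{-1}(1-q)(1-q^{\gamma+1})(1-q^{\gamma+2})>1$. Let $\alpha\in[0,1)$. Primes denote derivatives with respect to the variable $r$. Then: (a) The radius of convexity of order $\alpha$, $r^{c}_{\alpha}(f_{\gamma,\sigma}(z;q))$, is the smallest positive root $r$ of the equation $$\left(rf_{\gamma,\sigma}'(r;q)\right)'=\alpha f_{\gamma,\sigma}'(r;q).$$ (b) The radius of convexity of order $\alpha$, $r^{c}_{\alpha}(g_{\gamma,\sigma}(z;q))$, is the smallest positive root $r$ of the equation $$\left(rg_{\gamma,\sigma}'(r;q)\right)'=\alpha g_{\gamma,\sigma}'(r;q).$$ (c) The radius of convexity of order $\alpha$, $r^{c}_{\alpha}(h_{\gamma,\sigma}(z;q))$, is the smallest positive root $r$ of the equation $$\left(rh_{\gamma,\sigma}'(r;q)\right)'=\alpha h_{\gamma,\sigma}'(r;q).$$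
   Context: For $0<q<1$, $(a;q)_\infty=\prod_{k\ge1}(1-aq^{k-1})$ and the $q$-gamma function is $\Gamma_q(z)=\frac{(q;q)_\infty}{(q^z;q)_\infty}(1-q)^{1-z}$. For $\sigma>0$ and $0\le\gamma<2$ define the entire function $$\mathscr{E}_{\gamma,\sigma}(z;q)=\sum_{n\ge0}\frac{(-1)^n\sigma^{2n}q^{n(n-1)}}{\Gamma_q(2n+\gamma+1)}z^n .$$ Normalized functions: $f_{\gamma,\sigma}(z;q)=\left(z^{\gamma+1}\Gamma_q(\gamma+1)\mathscr{E}_{\gamma,\sigma}(z^2;q)\right)^{1/(\gamma+1)}$, meaning $z\left(\Gamma_q(\gamma+1)\mathscr{E}_{\gamma,\sigma}(z^2;q)\right)^{1/(\gamma+1)}$ on the largest disk $\mathbb{D}_\delta$ ($\delta\in(0,\infty]$) in which $z\mapsto\mathscr{E}_{\gamma,\sigma}(z^2;q)$ has no zeros, where the power is the analytic branch equal to $1$ at $z=0$ (so in (a) the equation is considered for $r\in(0,\delta)$); $g_{\gamma,\sigma}(z;q)=z\Gamma_q(\gamma+1)\mathscr{E}_{\gamma,\sigma}(z^2;q)$; $h_{\gamma,\sigma}(z;q)=z\Gamma_q(\gamma+1)\mathscr{E}_{\gamma,\sigma}(z;q)$. Write $\mathbb{D}_r=\{z\in\mathbb{C}:|z|<r\}$. For a function $f$ analytic in a disk centered at $0$ with $f(0)=0$, $f'(0)=1$, and $\alpha\in[0,1)$, the radius of convexity of order $\alpha$ is $$r^c_\alpha(f)=\sup\left\{r>0:\ \operatorname{Re}\left(1+\frac{zf''(z)}{f'(z)}\right)>\alpha\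 \text{for all } z\in\mathbb{D}_r\right\},$$ where $r$ ranges over radii such that $\mathbb{D}_r$ lies in the domain of $f$ (the condition includes that $f'$ has no zeros in $\mathbb{D}_r$). *)

theory Defs
  imports "HOL-Complex_Analysis.Complex_Analysis"
begin

definition qpoch_inf :: "complex \<Rightarrow> real \<Rightarrow> complex" where
  "qpoch_inf a q = (\<Prod>k. 1 - a * of_real q ^ k)"

definition q_Gamma :: "real \<Rightarrow> complex \<Rightarrow> complex" where
  "q_Gamma q z = qpoch_inf (of_real q) q / qpoch_inf (of_real q powr z) q
     * of_real (1 - q) powr (1 - z)"

definition calE :: "real \<Rightarrow> real \<Rightarrow> real \<Rightarrow> complex \<Rightarrow> complex" where
  "calE \<gamma> \<sigma> q z =
     (\<Sum>n. (-1) ^ n * of_real \<sigma> ^ (2 * n) * of_real q ^ (n * (n - 1))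
            / q_Gamma q (of_real (2 * real n + \<gamma> + 1)) * z ^ n)"

definition zero_free_radius :: "(complex \<Rightarrow> complex) \<Rightarrow> ereal" where
  "zero_free_radius F = Sup {ereal r | r. 0 < r \<and> (\<forall>z\<in>ball 0 r. F z \<noteq> 0)}"

text \<open>
  The analytic branch on \<open>S\<close> of the power \<open>F\<^sup>a\<close> that equals \<open>1\<close> at \<open>0\<close>. On a disk
  \<open>S\<close> around \<open>0\<close> on which the holomorphic function \<open>F\<close> has no zeros and \<open>F 0 = 1\<close>,
  its values are uniquely determined; its values outside \<open>S\<close> are arbitrary.
\<close>
definition power_branch ::
    "complex set \<Rightarrow> (complex \<Rightarrow> complex) \<Rightarrow> real \<Rightarrow> complex \<Rightarrow> complex" where
  "power_branch S F a =
     (SOME p. p 0 = 1 \<and>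
        (\<exists>L. L holomorphic_on S \<and>
             (\<forall>z\<in>S. exp (L z) = F z \<and> p z = exp (of_real a * L z))))"

definition f_radius :: "real \<Rightarrow> real \<Rightarrow> real \<Rightarrow> ereal" where
  "f_radius \<gamma> \<sigma> q = zero_free_radius (\<lambda>z. calE \<gamma> \<sigma> q (z\<^sup>2))"

text \<open>Only meaningful on the disk of radius \<open>f_radius \<gamma> \<sigma> q\<close>.\<close>
definition f_norm :: "real \<Rightarrow> real \<Rightarrow> real \<Rightarrow> complex \<Rightarrow> complex" where
  "f_norm \<gamma> \<sigma> q z =
     z * power_branch (eball 0 (f_radius \<gamma> \<sigma> q))
           (\<lambda>w. q_Gamma q (of_real (\<gamma> + 1)) * calE \<gamma> \<sigma> q (w\<^sup>2)) (1 / (\<gamma> + 1)) z"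

definition g_norm :: "real \<Rightarrow> real \<Rightarrow> real \<Rightarrow> complex \<Rightarrow> complex" where
  "g_norm \<gamma> \<sigma> q z = z * q_Gamma q (of_real (\<gamma> + 1)) * calE \<gamma> \<sigma> q (z\<^sup>2)"

definition h_norm :: "real \<Rightarrow> real \<Rightarrow> real \<Rightarrow> complex \<Rightarrow> complex" where
  "h_norm \<gamma> \<sigma> q z = z * q_Gamma q (of_real (\<gamma> + 1)) * calE \<gamma> \<sigma> q z"

text \<open>The domain of \<open>f\<close> is the disk \<open>eball 0 \<delta>\<close>, the whole plane if \<open>\<delta> = \<infinity>\<close>.\<close>
definition radius_of_convexity :: "ereal \<Rightarrow> real \<Rightarrow> (complex \<Rightarrow> complex) \<Rightarrow> ereal" where
  "radius_of_convexity \<delta> \<alpha> f =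
     Sup {ereal r | r. 0 < r \<and> ball (0::complex) r \<subseteq> eball 0 \<delta> \<and>
            (\<forall>z\<in>ball 0 r. deriv f z \<noteq> 0 \<and>
               Re (1 + z * deriv (deriv f) z / deriv f z) > \<alpha>)}"

text \<open>
  The equation \<open>(r f'(r))' = \<alpha> f'(r)\<close>; primes are derivatives with respect to the real
  variable \<open>r\<close> of functions that are a priori complex valued.
\<close>
definition convexity_equation :: "real \<Rightarrow> (complex \<Rightarrow> complex) \<Rightarrow> real \<Rightarrow> bool" where
  "convexity_equation \<alpha> f r \<longleftrightarrow>
     (let f' = (\<lambda>t. vector_derivative (\<lambda>s. f (of_real s)) (at t))
      in vector_derivative (\<lambda>t. of_real t * f' t) (at r) = of_real \<alpha> * f' r)"

text \<open>Here \<open>\<rho>\<close> is the least root of the equation \<open>P\<close> in \<open>(0, \<delta>)\<close>; in particular a root exists.\<close>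
definition is_smallest_positive_root :: "ereal \<Rightarrow> (real \<Rightarrow> bool) \<Rightarrow> ereal \<Rightarrow> bool" where
  "is_smallest_positive_root \<delta> P \<rho> \<longleftrightarrow>
     (\<exists>r. \<rho> = ereal r \<and> 0 < r \<and> ereal r < \<delta> \<and> P r \<and>
          (\<forall>s. 0 < s \<and> ereal s < \<delta> \<and> P s \<longrightarrow> r \<le> s))"

end

theory Submission
  imports Defs
begin

text \<open>
  Let \<open>\<Phi> = \<Gamma>\<^sub>q(\<gamma> + 1) \<E>\<close>. It is a locally uniform limit of polynomials \<open>\<Prod>\<^sub>i (1 - \<mu>\<^sub>i x)\<close> with
  \<open>\<mu>\<^sub>i > 0\<close>. If \<open>\<gamma> \<in> {0, 1}\<close>, the denominator of the coefficients is
  \<open>(q\<^sup>2; q\<^sup>2)\<^sub>k (b; q\<^sup>2)\<^sub>k\<close>, and the polynomials arise from the \<open>q\<^sup>2\<close>-Pochhammer polynomials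
  by repeated application of \<open>P \<mapsto> P(x) - c P(q\<^sup>2 x)\<close>. Otherwise the hypothesis forces \<open>q < 1/2\<close>, and
  the truncations of the power series are real-rooted by Kurtz's criterion.

  All three normalizations have the form \<open>f = z p(z)\<close> with \<open>W = 1 + z p'/p = 1 + c x \<Phi>'(x)/\<Phi>(x)\<close>,
  \<open>x = z\<^sup>m\<close>, and \<open>1 + z f''/f' = W + z W'/W\<close>. For the polynomials,
  \<open>x \<Phi>'/\<Phi> = - \<Sum>\<^sub>i \<mu>\<^sub>i x / (1 - \<mu>\<^sub>i x)\<close> and its \<open>x d/dx\<close>-derivative is \<open>- \<Sum>\<^sub>i \<mu>\<^sub>i x / (1 - \<mu>\<^sub>i x)\<^sup>2\<close>,
  so in the limit \<open>Re (W z) \<ge> W r\<close> and \<open>|z W'(z)| \<le> - r W'(r)\<close> for \<open>|z| = r\<close>. Hence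
  \<open>Re (1 + z f''/f')\<close> is minimal on \<open>|z| = r\<close> at \<open>z = r\<close>, as long as \<open>W > 0\<close> on \<open>[0, r]\<close>.
\<close>

section \<open>Limits of polynomials with positive roots\<close>

text \<open>Keeping the roots in finite products replaces any factorization theorem for entire
  functions: both estimates on |z| = r are sums over finitely many positive roots, and being
  non-strict they survive the limit.

  What the limit does not supply is a positive zero of \<Phi>. If there were none, all \<mu>_i would
  tend to 0 and \<Phi> would look like exp(-c x), with \<Phi>''(0) = \<Phi>'(0)^2; the first two
  coefficients rule this out. The first positive zero l then bounds the search: with R = l^(1/m), W
  reaches 0 before R, and W + r W'/W meets \<alpha> before W reaches 0. So the wanted root precedes
  the first positive zero of f', and W > 0 up to it.

  The case distinction reflects two sources of real roots. For \<gamma> in {0, 1} the factor (q^2;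
  q^2)_k is the one of the q-binomial theorem, which works for every q in (0, 1). Otherwise the
  decay of the coefficients is used: their consecutive quotients shrink at least by the factor q^2,
  and Kurtz's condition asks for a factor below 1/4, hence q < 1/2.\<close>

definition logd :: "(complex \<Rightarrow> complex) \<Rightarrow> complex \<Rightarrow> complex" where
  "logd F x = deriv F x / F x"

text \<open>The form F''/F - (F'/F)^2 is kept because it is continuous in F, F', F'' and so passes
  directly to the limit in \<open>logd_tendsto\<close>.\<close>

lemma logd_field_derivative:
  assumes "F holomorphic_on S" "open S" "x \<in> S" "F x \<noteq> 0"
  shows "(logd F has_field_derivative deriv (deriv F) x / F x - (logd F x)\<^sup>2) (at x)"
proof -
  have "(F has_field_derivative deriv F x) (at x)"
    using assms holomorphic_derivI by blast
  moreover have "(deriv F has_field_derivative deriv (deriv F) x) (at x)"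
    using assms holomorphic_deriv holomorphic_derivI by blast
  ultimately have "((\<lambda>x. deriv F x / F x) has_field_derivative
      (deriv (deriv F) x * F x - deriv F x * deriv F x) / (F x * F x)) (at x)"
    using assms(4) by (intro DERIV_divide)
  moreover have "(deriv (deriv F) x * F x - deriv F x * deriv F x) / (F x * F x)
      = deriv (deriv F) x / F x - (logd F x)\<^sup>2"
    using assms(4) by (simp add: logd_def field_simps power2_eq_square)
  ultimately show ?thesis
    by (simp add: logd_def[abs_def])
qed

text \<open>The second identity compares two derivatives of \<open>logd P\<close> at x: the general
  one from \<open>logd_field_derivative\<close> and the termwise one of the sum.\<close>

lemma logd_prod_linear:
  fixes \<mu> :: "nat \<Rightarrow> real" and n :: nat
  defines "P \<equiv> \<lambda>x::complex. \<Prod>i<n. 1 - of_real (\<mu> i) * x"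
  assumes "P x \<noteq> 0"
  shows "logd P x = - (\<Sum>i<n. of_real (\<mu> i) / (1 - of_real (\<mu> i) * x))"
    and "deriv (deriv P) x / P x - (logd P x)\<^sup>2 =
           - (\<Sum>i<n. (of_real (\<mu> i) / (1 - of_real (\<mu> i) * x))\<^sup>2)"
proof -
  have hol: "P holomorphic_on UNIV"
    unfolding P_def by (intro holomorphic_intros)
  have logd: "logd P y = - (\<Sum>i<n. of_real (\<mu> i) / (1 - of_real (\<mu> i) * y))" if "P y \<noteq> 0" for y
  proof -
    have nz: "1 - of_real (\<mu> i) * y \<noteq> 0" if "i < n" for i
      using \<open>P y \<noteq> 0\<close> that by (auto simp: P_def)
    have "(P has_field_derivative P y * (\<Sum>i<n. - of_real (\<mu> i) / (1 - of_real (\<mu> i) * y))) (at y)"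
      unfolding P_def using nz
      by (intro has_field_derivative_prod') (auto intro!: derivative_eq_intros)
    then show ?thesis
      using that by (simp add: logd_def DERIV_imp_deriv sum_negf)
  qed
  show "logd P x = - (\<Sum>i<n. of_real (\<mu> i) / (1 - of_real (\<mu> i) * x))"
    using logd assms(2) .
  have nz: "1 - of_real (\<mu> i) * x \<noteq> 0" if "i < n" for i
    using \<open>P x \<noteq> 0\<close> that by (auto simp: P_def)
  have "(\<Sum>i<n. of_real (\<mu> i) * of_real (\<mu> i) / (1 - of_real (\<mu> i) * x)\<^sup>2)
      = (\<Sum>i<n. (of_real (\<mu> i) / (1 - of_real (\<mu> i) * x))\<^sup>2)"
    by (simp add: power_divide power2_eq_square)
  moreover have "((\<lambda>y. - (\<Sum>i<n. of_real (\<mu> i) / (1 - of_real (\<mu> i) * y))) has_field_derivative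
      - (\<Sum>i<n. of_real (\<mu> i) * of_real (\<mu> i) / (1 - of_real (\<mu> i) * x)\<^sup>2)) (at x)"
    using nz by (auto intro!: derivative_eq_intros sum.cong simp: power2_eq_square)
  \<comment> \<open>The sum formula holds only where P is nonzero, so differentiating it needs a
    whole neighbourhood of x.\<close>
  moreover have "\<forall>\<^sub>F y in nhds x. logd P y = - (\<Sum>i<n. of_real (\<mu> i) / (1 - of_real (\<mu> i) * y))"
  proof -
    have "open (P -` (- {0}))"
      using hol by (intro open_vimage holomorphic_on_imp_continuous_on) auto
    then have "\<forall>\<^sub>F y in nhds x. y \<in> P -` (- {0})"
      using assms(2) by (intro eventually_nhds_in_open) auto
    then show ?thesis
      by eventually_elim (auto intro: logd)
  qed
  ultimately have "(logd P has_field_derivative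
      - (\<Sum>i<n. (of_real (\<mu> i) / (1 - of_real (\<mu> i) * x))\<^sup>2)) (at x)"
    by (simp add: DERIV_cong_ev)
  then show "deriv (deriv P) x / P x - (logd P x)\<^sup>2 =
           - (\<Sum>i<n. (of_real (\<mu> i) / (1 - of_real (\<mu> i) * x))\<^sup>2)"
    using logd_field_derivative[OF hol _ _ assms(2)] by (auto intro: DERIV_unique)
qed

lemma Re_div_one_minus_le:
  fixes y :: complex
  assumes "norm y < 1"
  shows "Re (y / (1 - y)) \<le> norm y / (1 - norm y)"
proof -
  have "y \<noteq> 1"
    using assms by auto
  then have "y / (1 - y) = 1 / (1 - y) - 1"
    by (simp add: field_simps)
  then have "Re (y / (1 - y)) \<le> norm (1 / (1 - y)) - 1"
    using complex_Re_le_cmod[of "1 / (1 - y)"] by simp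
  also have "norm (1 / (1 - y)) \<le> 1 / (1 - norm y)"
    using assms norm_triangle_ineq2[of 1 y] by (simp add: norm_divide frac_le)
  also have "1 / (1 - norm y) - 1 = norm y / (1 - norm y)"
    using assms by (simp add: field_simps)
  finally show ?thesis by simp
qed

text \<open>These are Laguerre-Polya functions with value 1 at 0. The numbers
  \<open>\<mu> N i\<close> are reciprocals of roots, so a root that escapes to infinity simply
  becomes a small \<open>\<mu>\<close>.\<close>

locale pos_root_limit =
  fixes \<Phi> :: "complex \<Rightarrow> complex" and n :: "nat \<Rightarrow> nat" and \<mu> :: "nat \<Rightarrow> nat \<Rightarrow> real"
  assumes \<mu>_pos: "0 < \<mu> N i"
    and ulim: "uniform_limit (cball 0 R) (\<lambda>N x. \<Prod>i<n N. 1 - of_real (\<mu> N i) * x) \<Phi> sequentially"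
begin

definition P :: "nat \<Rightarrow> complex \<Rightarrow> complex" where
  "P N = (\<lambda>x. \<Prod>i<n N. 1 - of_real (\<mu> N i) * x)"

lemma uniform_limit_P: "uniform_limit (cball 0 R) P \<Phi> sequentially"
  using ulim unfolding P_def .

lemma holomorphic_P: "P N holomorphic_on S"
  unfolding P_def by (intro holomorphic_intros)

lemma tendsto: "(\<lambda>N. P N x) \<longlonglongrightarrow> \<Phi> x"
  using tendsto_uniform_limitI[OF uniform_limit_P[of "norm x"], of x] by simp

lemma holomorphic: "\<Phi> holomorphic_on S"
proof -
  have "\<Phi> holomorphic_on ball 0 R" for R
    by (rule holomorphic_uniform_limit[OF _ uniform_limit_P[of R]])
       (auto intro!: always_eventually holomorphic_on_imp_continuous_on holomorphic_P)
  then have "\<Phi> field_differentiable at x" for x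
    by (metis dist_norm holomorphic_on_imp_differentiable_at open_ball mem_ball diff_0 norm_minus_cancel gt_ex)
  then show ?thesis
    by (simp add: holomorphic_on_def field_differentiable_at_within)
qed

lemma deriv_tendsto: "(\<lambda>N. deriv (P N) x) \<longlonglongrightarrow> deriv \<Phi> x"
  and deriv2_tendsto: "(\<lambda>N. deriv (deriv (P N)) x) \<longlonglongrightarrow> deriv (deriv \<Phi>) x"
proof -
  have "(\<lambda>N. (deriv ^^ m) (P N) x) \<longlonglongrightarrow> (deriv ^^ m) \<Phi> x" for m
    by (rule higher_deriv_complex_uniform_limit[where A = "ball 0 (norm x + 1)"])
       (auto intro!: always_eventually holomorphic_P uniform_limit_on_subset[OF uniform_limit_P[of "norm x + 1"]])
  from this[of 1] this[of 2] show "(\<lambda>N. deriv (P N) x) \<longlonglongrightarrow> deriv \<Phi> x"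
    "(\<lambda>N. deriv (deriv (P N)) x) \<longlonglongrightarrow> deriv (deriv \<Phi>) x"
    by (simp_all add: numeral_2_eq_2)
qed

lemma at_0 [simp]: "\<Phi> 0 = 1"
  using tendsto[of 0] by (simp add: P_def LIMSEQ_const_iff)

lemma Reals: "\<Phi> (of_real t) \<in> \<real>"
proof (rule closed_sequentially[OF closed_complex_Reals _ tendsto])
  show "P N (of_real t) \<in> \<real>" for N by (auto simp: P_def intro!: prod_in_Reals)
qed

lemma logd_tendsto:
  assumes "\<Phi> x \<noteq> 0"
  shows "(\<lambda>N. logd (P N) x) \<longlonglongrightarrow> logd \<Phi> x"
    and "(\<lambda>N. deriv (deriv (P N)) x / P N x - (logd (P N) x)\<^sup>2)
           \<longlonglongrightarrow> deriv (deriv \<Phi>) x / \<Phi> x - (logd \<Phi> x)\<^sup>2"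
  unfolding logd_def using assms
  by (intro tendsto_intros deriv_tendsto deriv2_tendsto tendsto; simp)+

lemma logd_P:
  assumes "P N x \<noteq> 0"
  shows "logd (P N) x = - (\<Sum>i<n N. of_real (\<mu> N i) / (1 - of_real (\<mu> N i) * x))"
    and "deriv (deriv (P N)) x / P N x - (logd (P N) x)\<^sup>2 =
           - (\<Sum>i<n N. (of_real (\<mu> N i) / (1 - of_real (\<mu> N i) * x))\<^sup>2)"
  using logd_prod_linear[where n = "n N" and \<mu> = "\<mu> N" and x = x] assms by (simp_all add: P_def)

lemma of_real_Re_at [simp]: "of_real (Re (\<Phi> (of_real t))) = \<Phi> (of_real t)"
  using Reals[of t] by (simp add: of_real_Re)

lemma continuous_on_real: "continuous_on A (\<lambda>t. Re (\<Phi> (of_real t)))"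
  by (intro continuous_intros continuous_on_compose2[OF holomorphic_on_imp_continuous_on[OF holomorphic[of UNIV]]]) auto

lemma Re_pos:
  assumes "0 \<le> r" "\<And>t. 0 \<le> t \<Longrightarrow> t \<le> r \<Longrightarrow> \<Phi> (of_real t) \<noteq> 0"
  shows "0 < Re (\<Phi> (of_real r))"
proof (rule ccontr)
  assume "\<not> ?thesis"
  then obtain t where "0 \<le> t" "t \<le> r" "Re (\<Phi> (of_real t)) = 0"
    using IVT2'[of "\<lambda>t. Re (\<Phi> (of_real t))" r 0 0] continuous_on_real assms(1) by auto
  then show False
    using assms(2)[of t] of_real_Re_at[of t] by simp
qed

text \<open>On the segment from 0 to r the limit has a positive minimum. An approximant uniformly
  closer than that minimum cannot vanish there, and all its roots lie on the positive axis.\<close>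

lemma eventually_roots_outside:
  assumes "0 < r" "\<And>t. 0 \<le> t \<Longrightarrow> t \<le> r \<Longrightarrow> \<Phi> (of_real t) \<noteq> 0"
  shows "\<forall>\<^sub>F N in sequentially. \<forall>i<n N. \<mu> N i * r < 1"
proof -
  have "\<exists>s\<in>{0..r}. \<forall>t\<in>{0..r}. Re (\<Phi> (of_real s)) \<le> Re (\<Phi> (of_real t))"
    using assms(1) by (intro continuous_attains_inf continuous_on_real) auto
  then obtain s where s: "s \<in> {0..r}" "\<And>t. t \<in> {0..r} \<Longrightarrow> Re (\<Phi> (of_real s)) \<le> Re (\<Phi> (of_real t))"
    by blast
  have s_pos: "0 < Re (\<Phi> (of_real s))"
    using s(1) assms by (intro Re_pos) auto
  have "\<forall>\<^sub>F N in sequentially. \<forall>x\<in>cball 0 r. dist (P N x) (\<Phi> x) < Re (\<Phi> (of_real s))"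
    using uniform_limitD[OF uniform_limit_P s_pos] .
  then show ?thesis
  proof eventually_elim
    case (elim N)
    show ?case
    proof (intro allI impI, rule ccontr)
      fix i assume i: "i < n N" "\<not> \<mu> N i * r < 1"
      define t where "t = 1 / \<mu> N i"
      have t: "t \<in> {0..r}"
        using i \<mu>_pos[of N i] assms(1) by (auto simp: t_def field_simps)
      have "of_real (\<mu> N i) * of_real t = (1::complex)"
        using \<mu>_pos[of N i] by (simp add: t_def flip: of_real_mult)
      then have "P N (of_real t) = 0"
        using i(1) unfolding P_def by (intro prod_zero) auto
      moreover have "dist (P N (of_real t)) (\<Phi> (of_real t)) < Re (\<Phi> (of_real s))"
        using t by (intro bspec[OF elim]) auto
      ultimately have "dist 0 (\<Phi> (of_real t)) < Re (\<Phi> (of_real s))"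
        by (simp only:)
      then show False
        using s(2)[OF t] complex_Re_le_cmod[of "\<Phi> (of_real t)"] by simp
    qed
  qed
qed

text \<open>Factor by factor, |1 - \<mu> x| is at least 1 - \<mu> |x|, which is positive once all
  roots exceed |x|. This carries nonvanishing from a real segment to the whole disk.\<close>

lemma norm_ge:
  assumes "\<And>t. 0 \<le> t \<Longrightarrow> t \<le> norm x \<Longrightarrow> \<Phi> (of_real t) \<noteq> 0"
  shows "norm (\<Phi> (of_real (norm x))) \<le> norm (\<Phi> x)"
proof (cases "x = 0")
  case False
  have "\<forall>\<^sub>F N in sequentially. norm (P N (of_real (norm x))) \<le> norm (P N x)"
    using eventually_roots_outside[of "norm x", OF _ assms, simplified, OF False]
  proof eventually_elim
    case (elim N)
    show ?case
      unfolding P_def prod_norm[symmetric]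
    proof (intro prod_mono conjI norm_ge_zero)
      fix i assume i: "i \<in> {..<n N}"
      have "norm (1 - of_real (\<mu> N i) * of_real (norm x) :: complex) = 1 - \<mu> N i * norm x"
      proof -
        have "1 - of_real (\<mu> N i) * of_real (norm x) = (of_real (1 - \<mu> N i * norm x) :: complex)"
          by simp
        also have "norm \<dots> = 1 - \<mu> N i * norm x"
          using elim i by (simp only: norm_of_real) (simp add: less_imp_le)
        finally show ?thesis .
      qed
      also have "\<dots> \<le> norm (1 - of_real (\<mu> N i) * x)"
        using norm_triangle_ineq2[of 1 "of_real (\<mu> N i) * x"] \<mu>_pos[of N i] by (simp add: norm_mult)
      finally show "norm (1 - of_real (\<mu> N i) * of_real (norm x) :: complex) \<le> norm (1 - of_real (\<mu> N i) * x)" .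
    qed
  qed
  then show ?thesis
    by (rule tendsto_le[OF sequentially_bot tendsto_norm[OF tendsto] tendsto_norm[OF tendsto]])
qed simp

lemma nonzero:
  assumes "\<And>t. 0 \<le> t \<Longrightarrow> t \<le> norm x \<Longrightarrow> \<Phi> (of_real t) \<noteq> 0"
  shows "\<Phi> x \<noteq> 0"
proof -
  have "norm (\<Phi> (of_real (norm x))) \<le> norm (\<Phi> x)"
    using assms by (rule norm_ge)
  then show ?thesis
    using assms[of "norm x"] by auto
qed

abbreviation dlogd :: "complex \<Rightarrow> complex" where
  "dlogd x \<equiv> deriv (deriv \<Phi>) x / \<Phi> x - (logd \<Phi> x)\<^sup>2"

text \<open>The second expression is the derivative of \<open>x * logd \<Phi> x\<close>. For the
  approximants it is minus the sum of \<mu> / (1 - \<mu> x)^2, and |1 - \<mu> x| \<ge> 1 - \<mu> |x|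
  > 0 bounds each term by its value at |x|.\<close>

lemma logd_bounds:
  assumes nz: "\<And>t. 0 \<le> t \<Longrightarrow> t \<le> norm x \<Longrightarrow> \<Phi> (of_real t) \<noteq> 0"
  shows "Re (of_real (norm x) * logd \<Phi> (of_real (norm x))) \<le> Re (x * logd \<Phi> x)"
    and "norm (logd \<Phi> x + x * dlogd x) \<le>
           - Re (logd \<Phi> (of_real (norm x)) + of_real (norm x) * dlogd (of_real (norm x)))"
proof -
  define r where "r = norm x"
  have r: "0 \<le> r" "norm (of_real r :: complex) = r"
    by (auto simp: r_def)
  have nzx: "\<Phi> x \<noteq> 0" "\<Phi> (of_real r) \<noteq> 0"
    using nonzero[OF nz] nz[of r] by (auto simp: r_def)
  have "\<forall>\<^sub>F N in sequentially. \<forall>i<n N. \<mu> N i * r < 1"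
  proof (cases "x = 0")
    case False
    then show ?thesis
      using eventually_roots_outside[of r] nz by (simp add: r_def)
  qed (simp add: r_def)
  then have *: "\<forall>\<^sub>F N in sequentially.
      Re (of_real r * logd (P N) (of_real r)) \<le> Re (x * logd (P N) x) \<and>
      norm (logd (P N) x + x * (deriv (deriv (P N)) x / P N x - (logd (P N) x)\<^sup>2)) \<le>
      - Re (logd (P N) (of_real r) + of_real r *
         (deriv (deriv (P N)) (of_real r) / P N (of_real r) - (logd (P N) (of_real r))\<^sup>2))"
  proof eventually_elim
    case (elim N)
    define m where "m = \<mu> N"
    have m: "0 < m i" "norm (of_real (m i) * x) = m i * r" for i
      using \<mu>_pos[of N i] by (simp_all add: m_def norm_mult r_def)
    have mr: "m i * r < 1" if "i < n N" for i
      using elim that by (simp add: m_def)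
    have nz1: "1 - of_real (m i) * y \<noteq> 0" if "i < n N" "norm y = r" for i and y :: complex
    proof
      assume "1 - of_real (m i) * y = 0"
      then have "norm (of_real (m i) * y) = 1" by simp
      then show False using mr[OF that(1)] that(2) m(1)[of i] by (simp add: norm_mult)
    qed
    have PN: "P N y \<noteq> 0" if "norm y = r" for y
      using nz1 that by (simp add: m_def P_def)
    have step: "logd (P N) y + y * (deriv (deriv (P N)) y / P N y - (logd (P N) y)\<^sup>2)
        = - (\<Sum>i<n N. of_real (m i) / (1 - of_real (m i) * y)\<^sup>2)"
      and step0: "y * logd (P N) y = - (\<Sum>i<n N. of_real (m i) * y / (1 - of_real (m i) * y))"
      if "norm y = r" for y
    proof -
      have "of_real (m i) / (1 - of_real (m i) * y) + y * (of_real (m i) / (1 - of_real (m i) * y))\<^sup>2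
          = of_real (m i) / (1 - of_real (m i) * y)\<^sup>2" if "i < n N" for i
        using nz1[OF that \<open>norm y = r\<close>] by (simp add: divide_simps) algebra
      then have "(\<Sum>i<n N. of_real (m i) / (1 - of_real (m i) * y)\<^sup>2)
          = (\<Sum>i<n N. of_real (m i) / (1 - of_real (m i) * y))
          + y * (\<Sum>i<n N. (of_real (m i) / (1 - of_real (m i) * y))\<^sup>2)"
        by (simp add: sum_distrib_left flip: sum.distrib)
      then show "logd (P N) y + y * (deriv (deriv (P N)) y / P N y - (logd (P N) y)\<^sup>2)
        = - (\<Sum>i<n N. of_real (m i) / (1 - of_real (m i) * y)\<^sup>2)"
        by (subst logd_P(2)[OF PN[OF that]], subst logd_P(1)[OF PN[OF that]]) (simp add: m_def)
      show "y * logd (P N) y = - (\<Sum>i<n N. of_real (m i) * y / (1 - of_real (m i) * y))"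
        unfolding logd_P(1)[OF PN[OF that]] by (simp add: sum_distrib_left m_def mult.commute)
    qed
    have "Re (\<Sum>i<n N. of_real (m i) * x / (1 - of_real (m i) * x))
        \<le> Re (\<Sum>i<n N. of_real (m i) * of_real r / (1 - of_real (m i) * of_real r))"
      unfolding Re_sum
    proof (intro sum_mono)
      fix i assume "i \<in> {..<n N}"
      then have "Re (of_real (m i) * x / (1 - of_real (m i) * x)) \<le> m i * r / (1 - m i * r)"
        using Re_div_one_minus_le[of "of_real (m i) * x"] mr m by simp
      also have "\<dots> = Re (of_real (m i * r / (1 - m i * r)))"
        by (simp only: Re_complex_of_real)
      finally show "Re (of_real (m i) * x / (1 - of_real (m i) * x))
          \<le> Re (of_real (m i) * of_real r / (1 - of_real (m i) * of_real r))"
        by simp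
    qed
    moreover have "norm (\<Sum>i<n N. of_real (m i) / (1 - of_real (m i) * x)\<^sup>2)
        \<le> Re (\<Sum>i<n N. of_real (m i) / (1 - of_real (m i) * of_real r)\<^sup>2)"
      unfolding Re_sum
    proof (intro sum_norm_le)
      fix i assume i: "i \<in> {..<n N}"
      have "1 - m i * r \<le> norm (1 - of_real (m i) * x)"
        using norm_triangle_ineq2[of 1 "of_real (m i) * x"] m(2) by simp
      then have "norm (of_real (m i) / (1 - of_real (m i) * x)\<^sup>2) \<le> m i / (1 - m i * r)\<^sup>2"
        using i mr[of i] m(1)[of i] by (simp add: norm_divide norm_power frac_le power_mono)
      also have "\<dots> = Re (of_real (m i / (1 - m i * r)\<^sup>2))"
        by (simp only: Re_complex_of_real)
      finally show "norm (of_real (m i) / (1 - of_real (m i) * x)\<^sup>2)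
          \<le> Re (of_real (m i) / (1 - of_real (m i) * of_real r)\<^sup>2)"
        by simp
    qed
    ultimately show ?case
      using step[of x] step[of "of_real r"] step0[of x] step0[of "of_real r"] r by (simp add: r_def[symmetric])
  qed
  show "Re (of_real (norm x) * logd \<Phi> (of_real (norm x))) \<le> Re (x * logd \<Phi> x)"
    unfolding r_def[symmetric]
    using eventually_conj_iff[THEN iffD1, OF *, THEN conjunct1]
    by (rule tendsto_le[OF sequentially_bot, rotated 2]) (intro tendsto_intros logd_tendsto nzx)+
  show "norm (logd \<Phi> x + x * dlogd x) \<le>
           - Re (logd \<Phi> (of_real (norm x)) + of_real (norm x) * dlogd (of_real (norm x)))"
    unfolding r_def[symmetric]
    using eventually_conj_iff[THEN iffD1, OF *, THEN conjunct2]
    by (rule tendsto_le[OF sequentially_bot, rotated 2]) (intro tendsto_intros logd_tendsto nzx)+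
qed

lemma logd_Reals:
  assumes "\<Phi> (of_real t) \<noteq> 0"
  shows "logd \<Phi> (of_real t) \<in> \<real>" "dlogd (of_real t) \<in> \<real>"
proof -
  have "\<forall>\<^sub>F N in sequentially. P N (of_real t) \<noteq> 0"
    using tendsto assms by (rule tendsto_imp_eventually_ne)
  then have *: "\<forall>\<^sub>F N in sequentially. logd (P N) (of_real t) \<in> \<real>"
    "\<forall>\<^sub>F N in sequentially. deriv (deriv (P N)) (of_real t) / P N (of_real t) - (logd (P N) (of_real t))\<^sup>2 \<in> \<real>"
    by (eventually_elim, subst logd_P, simp, force intro!: sum_in_Reals)+
  show "logd \<Phi> (of_real t) \<in> \<real>"
    by (rule Lim_in_closed_set[OF closed_complex_Reals *(1) sequentially_bot logd_tendsto(1)[OF assms]])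
  show "dlogd (of_real t) \<in> \<real>"
    by (rule Lim_in_closed_set[OF closed_complex_Reals *(2) sequentially_bot logd_tendsto(2)[OF assms]])
qed

text \<open>Without a positive zero, any r > 0 eventually lies below all roots, so \<mu>_i < 1/r and
  the sum of the \<mu>_i^2 is at most 1/r times the sum of the \<mu>_i. Up to sign these sums are
  the approximants' values of \<open>dlogd\<close> and \<open>logd\<close> at 0. As r is arbitrary,
  \<open>dlogd 0 = 0\<close>.\<close>

lemma zero_exists:
  assumes "deriv (deriv \<Phi>) 0 \<noteq> (deriv \<Phi> 0)\<^sup>2"
  shows "\<exists>r>0. \<Phi> (of_real r) = 0"
proof (rule ccontr)
  assume *: "\<not> ?thesis"
  have nz: "\<Phi> (of_real t) \<noteq> 0" if "0 \<le> t" for t :: real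
    using \<open>0 \<le> t\<close> * that by (cases "t = 0") auto
  have bound: "r * norm (dlogd 0) \<le> norm (logd \<Phi> 0)" if r: "0 < r" for r
  proof -
    have "\<forall>\<^sub>F N in sequentially. r * norm (deriv (deriv (P N)) 0 / P N 0 - (logd (P N) 0)\<^sup>2) \<le> norm (logd (P N) 0)"
    proof -
      have "\<forall>\<^sub>F N in sequentially. \<forall>i<n N. \<mu> N i * r < 1"
        using r nz by (intro eventually_roots_outside)
      then show ?thesis
    proof eventually_elim
      case (elim N)
      have "(\<Sum>i<n N. r * (\<mu> N i)\<^sup>2) \<le> (\<Sum>i<n N. \<mu> N i)"
      proof (intro sum_mono)
        fix i assume "i \<in> {..<n N}"
        then show "r * (\<mu> N i)\<^sup>2 \<le> \<mu> N i"
          using mult_right_mono[of "\<mu> N i * r" 1 "\<mu> N i"] \<mu>_pos[of N i] elim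
          by (simp add: power2_eq_square mult_ac less_imp_le)
      qed
      moreover have "norm (\<Sum>i<n N. complex_of_real (\<mu> N i)) = (\<Sum>i<n N. \<mu> N i)"
        "norm (\<Sum>i<n N. (complex_of_real (\<mu> N i))\<^sup>2) = (\<Sum>i<n N. (\<mu> N i)\<^sup>2)"
        using \<mu>_pos by (simp_all flip: of_real_sum of_real_power add: sum_nonneg less_imp_le)
      ultimately show ?case
        using logd_P[of N 0] by (simp add: sum_distrib_left P_def)
    qed
    qed
    moreover have "\<Phi> 0 \<noteq> 0"
      by simp
    ultimately show ?thesis
      using tendsto_le[OF sequentially_bot tendsto_norm[OF logd_tendsto(1)]
            tendsto_mult_left[OF tendsto_norm[OF logd_tendsto(2)]]] by blast
  qed
  \<comment> \<open>The chosen r turns the left side of \<open>bound\<close> into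
    \<open>norm (logd \<Phi> 0) + 1\<close>.\<close>
  have "norm (logd \<Phi> 0) + 1 \<le> norm (logd \<Phi> 0)" if "dlogd 0 \<noteq> 0"
    using bound[of "(norm (logd \<Phi> 0) + 1) / norm (dlogd 0)"] that
    by (simp add: add_nonneg_pos)
  then have "dlogd 0 = 0" by fastforce
  then show False
    using assms by (simp add: logd_def)
qed

end

section \<open>Radii of convexity\<close>

lemma first_zero_exists:
  fixes e :: "real \<Rightarrow> real"
  assumes "continuous_on {0..b} e" "0 < e 0" "e b \<le> 0" "0 \<le> b"
  obtains \<rho> where "0 < \<rho>" "\<rho> \<le> b" "e \<rho> = 0" "\<And>t. 0 \<le> t \<Longrightarrow> t < \<rho> \<Longrightarrow> 0 < e t"
proof -
  define S where "S = {t \<in> {0..b}. e t \<in> {..0}}"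
  have "closed ({0..b} \<inter> e -` {..0})"
    by (intro continuous_closed_preimage assms) auto
  then have "compact ({0..b} \<inter> ({0..b} \<inter> e -` {..0}))"
    by (intro compact_Int_closed) auto
  also have "{0..b} \<inter> ({0..b} \<inter> e -` {..0}) = S"
    by (auto simp: S_def)
  finally have "compact S" .
  moreover have "b \<in> S"
    using assms by (auto simp: S_def)
  ultimately obtain \<rho> where \<rho>: "\<rho> \<in> S" "\<And>t. t \<in> S \<Longrightarrow> \<rho> \<le> t"
    using compact_attains_inf[of S] by blast
  have pos: "0 < e t" if "0 \<le> t" "t < \<rho>" for t
    using \<rho>(2)[of t] that \<rho>(1) by (force simp: S_def)
  \<comment> \<open>So far only \<open>e \<rho> \<le> 0\<close> is known; a zero at or before \<rho>
    must be \<rho> itself, since e is positive earlier.\<close>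
  have "\<exists>t\<ge>0. t \<le> \<rho> \<and> e t = 0"
    using \<rho>(1) assms by (intro IVT2') (auto simp: S_def intro: continuous_on_subset)
  then have "e \<rho> = 0"
    using pos by (metis less_irrefl order_le_less)
  moreover have "0 < \<rho>"
    using \<rho>(1) assms(2) calculation by (cases "\<rho> = 0") (auto simp: S_def)
  ultimately show thesis
    using that pos \<rho>(1) by (auto simp: S_def)
qed

text \<open>Both existence arguments are Rolle's theorem: \<open>r p r\<close> vanishes at \<open>0\<close> and at \<open>R\<close>, hence
  its derivative \<open>w p\<close> vanishes at some \<open>r0 < R\<close>; then \<open>r w p\<close> vanishes at \<open>0\<close> and at \<open>r0\<close>.\<close>
lemma convexity_root_exists:
  fixes w w' p :: "real \<Rightarrow> real"
  assumes "0 < R" "0 \<le> \<alpha>" "\<alpha> < 1"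
    and p_pos: "\<And>t. 0 \<le> t \<Longrightarrow> t < R \<Longrightarrow> 0 < p t"
    and p_deriv: "\<And>t. 0 \<le> t \<Longrightarrow> t < R \<Longrightarrow> \<exists>D. (p has_real_derivative D) (at t) \<and> t * D = (w t - 1) * p t"
    and w_deriv: "\<And>t. 0 \<le> t \<Longrightarrow> t < R \<Longrightarrow> (w has_real_derivative w' t) (at t)"
    and w'_cont: "continuous_on {0..<R} w'"
    and lim: "(p \<longlongrightarrow> 0) (at_left R)"
  obtains \<rho> where "0 < \<rho>" "\<rho> < R" "\<And>t. 0 \<le> t \<Longrightarrow> t \<le> \<rho> \<Longrightarrow> 0 < w t"
    "(w \<rho>)\<^sup>2 + \<rho> * w' \<rho> = \<alpha> * w \<rho>"
    "\<And>t. 0 \<le> t \<Longrightarrow> t < \<rho> \<Longrightarrow> \<alpha> * w t < (w t)\<^sup>2 + t * w' t"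
proof -
  have w_cont: "continuous_on {0..<R} w"
    by (intro continuous_at_imp_continuous_on ballI) (metis w_deriv DERIV_isCont atLeastLessThan_iff)
  have p_cont: "continuous_on {0..<R} p"
    by (intro continuous_at_imp_continuous_on ballI) (metis p_deriv DERIV_isCont atLeastLessThan_iff)
  \<comment> \<open>At t = 0 the relation \<open>t * D = (w t - 1) * p t\<close> degenerates to this
    value.\<close>
  have w0: "w 0 = 1"
    using p_deriv[of 0] p_pos[of 0] \<open>0 < R\<close> by auto
  have rp_deriv: "((\<lambda>t. t * p t) has_real_derivative w t * p t) (at t)" if t: "0 \<le> t" "t < R" for t
  proof -
    obtain D where D: "(p has_real_derivative D) (at t)" "t * D = (w t - 1) * p t"
      using p_deriv t by blast
    show ?thesis
      by (rule derivative_eq_intros D refl)+ (use D(2) in \<open>simp add: algebra_simps\<close>)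
  qed
  have "\<exists>b. 0 \<le> b \<and> b < R \<and> w b \<le> 0"
  proof (rule ccontr)
    assume "\<nexists>b. 0 \<le> b \<and> b < R \<and> w b \<le> 0"
    then have w_pos: "0 < w t" if "0 \<le> t" "t < R" for t
      using that by force
    \<comment> \<open>At R only a one-sided limit of p is given, so Rolle's theorem is replaced by
      monotonicity of t p(t); the starting point R/2 is arbitrary.\<close>
    have "R/2 * p (R/2) \<le> t * p t" if t: "R/2 < t" "t < R" for t
    proof (rule DERIV_nonneg_imp_nondecreasing[where f = "\<lambda>t. t * p t"])
      fix s assume "R/2 \<le> s" "s \<le> t"
      then have "0 \<le> s" "s < R"
        using t \<open>0 < R\<close> by auto
      then show "\<exists>y. ((\<lambda>t. t * p t) has_real_derivative y) (at s) \<and> 0 \<le> y"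
        using rp_deriv w_pos p_pos by (intro exI[of _ "w s * p s"]) (auto simp: less_imp_le)
    qed (use t in auto)
    then have "\<forall>\<^sub>F t in at_left R. R/2 * p (R/2) \<le> t * p t"
      using \<open>0 < R\<close> by (intro eventually_at_leftI[of "R/2"]) auto
    moreover have "((\<lambda>t. t * p t) \<longlongrightarrow> R * 0) (at_left R)"
      by (intro tendsto_intros lim)
    ultimately have "R/2 * p (R/2) \<le> R * 0"
      by (intro tendsto_le[OF trivial_limit_at_left_real _ tendsto_const])
    then show False
      using p_pos[of "R/2"] \<open>0 < R\<close> by (simp add: mult_le_0_iff)
  qed
  then obtain b where b: "0 \<le> b" "b < R" "w b \<le> 0"
    by blast
  moreover from this have "continuous_on {0..b} w"
    by (auto intro: continuous_on_subset[OF w_cont])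
  ultimately obtain r where r: "0 < r" "r \<le> b" "w r = 0" "\<And>t. 0 \<le> t \<Longrightarrow> t < r \<Longrightarrow> 0 < w t"
    using first_zero_exists[of b w] w0 by auto
  \<comment> \<open>While w > 0, the sign of e is that of w + t w'/w - \<alpha>, the quantity that
    the convexity condition makes positive.\<close>
  define e where "e t = (w t)\<^sup>2 + t * w' t - \<alpha> * w t" for t
  have e_cont: "continuous_on {0..<R} e"
    unfolding e_def by (intro continuous_intros w_cont w'_cont)
  have rwp_deriv: "((\<lambda>t. t * (w t * p t)) has_real_derivative (e t + \<alpha> * w t) * p t) (at t)" if t: "0 \<le> t" "t < R" for t
  proof -
    obtain D where D: "(p has_real_derivative D) (at t)" "t * D = (w t - 1) * p t"
      using p_deriv t by blast
    have "((\<lambda>t. t * (w t * p t)) has_real_derivative w t * p t + (t * w' t * p t + w t * (t * D))) (at t)"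
      by (rule derivative_eq_intros D w_deriv t refl)+ (simp add: algebra_simps)
    moreover have "w t * p t + (t * w' t * p t + w t * (t * D)) = (e t + \<alpha> * w t) * p t"
      unfolding D(2) by (simp add: e_def algebra_simps power2_eq_square)
    ultimately show ?thesis by simp
  qed
  have "\<exists>b. 0 \<le> b \<and> b < r \<and> e b \<le> 0"
  proof (rule ccontr)
    assume "\<nexists>b. 0 \<le> b \<and> b < r \<and> e b \<le> 0"
    then have e_pos: "0 < e t" if "0 \<le> t" "t < r" for t
      using that by force
    \<comment> \<open>With e > 0 and \<alpha> w \<ge> 0, the function t w p would increase strictly
      from 0 at t = 0 to 0 at t = r.\<close>
    have "0 * (w 0 * p 0) < r * (w r * p r)"
    proof (rule DERIV_pos_imp_increasing_open[where f = "\<lambda>t. t * (w t * p t)"])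
      fix t assume t: "0 < t" "t < r"
      then have "0 < (e t + \<alpha> * w t) * p t"
        using e_pos[of t] r(4)[of t] p_pos[of t] r(2) b assms(2)
        by (intro mult_pos_pos add_pos_nonneg mult_nonneg_nonneg) (auto simp: less_imp_le)
      then show "\<exists>y. ((\<lambda>t. t * (w t * p t)) has_real_derivative y) (at t) \<and> 0 < y"
        using rwp_deriv[of t] t r(2) b by auto
    qed (use r b in \<open>auto intro!: continuous_intros continuous_on_subset[OF w_cont] continuous_on_subset[OF p_cont]\<close>)
    then show False
      using r(3) by simp
  qed
  then obtain c where c: "0 \<le> c" "c < r" "e c \<le> 0"
    by blast
  moreover from this have "continuous_on {0..c} e"
    using b r by (auto intro: continuous_on_subset[OF e_cont])
  \<comment> \<open>\<open>e 0 = 1 - \<alpha>\<close>, which is where \<alpha> < 1 enters.\<close>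
  moreover have "0 < e 0"
    using w0 assms(3) by (simp add: e_def)
  ultimately obtain \<rho> where "0 < \<rho>" "\<rho> \<le> c" "e \<rho> = 0" "\<And>t. 0 \<le> t \<Longrightarrow> t < \<rho> \<Longrightarrow> 0 < e t"
    using first_zero_exists[of c e] by auto
  then show thesis
    using b r c by (intro that[of \<rho>]) (auto simp: e_def)
qed

text \<open>\<open>W z = 1 + z p'(z) / p(z)\<close>, so that \<open>f' = p W\<close> and \<open>1 + z f'' / f' = W + z W' / W\<close>.\<close>
locale convexity_setup =
  fixes f p W W' :: "complex \<Rightarrow> complex" and w w' P :: "real \<Rightarrow> real" and R \<alpha> :: real and \<delta> :: ereal
  assumes R: "0 < R" "ereal R \<le> \<delta>" and \<alpha>: "0 \<le> \<alpha>" "\<alpha> < 1"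
    and f_eq: "z \<in> ball 0 R \<Longrightarrow> f z = z * p z"
    and p_nz: "z \<in> ball 0 R \<Longrightarrow> p z \<noteq> 0"
    and p_deriv: "z \<in> ball 0 R \<Longrightarrow> \<exists>D. (p has_field_derivative D) (at z) \<and> z * D = (W z - 1) * p z"
    and W_deriv: "z \<in> ball 0 R \<Longrightarrow> (W has_field_derivative W' z) (at z)"
    and W_Re: "z \<in> ball 0 R \<Longrightarrow> w (norm z) \<le> Re (W z)"
    and W'_norm: "z \<in> ball 0 R \<Longrightarrow> norm (z * W' z) \<le> - norm z * w' (norm z)"
    and W_real: "0 \<le> t \<Longrightarrow> t < R \<Longrightarrow> W (of_real t) = of_real (w t)"
    and W'_real: "0 \<le> t \<Longrightarrow> t < R \<Longrightarrow> W' (of_real t) = of_real (w' t)"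
    and P_pos: "\<And>t. 0 \<le> t \<Longrightarrow> t < R \<Longrightarrow> 0 < P t"
    and P_deriv: "\<And>t. 0 \<le> t \<Longrightarrow> t < R \<Longrightarrow> \<exists>D. (P has_real_derivative D) (at t) \<and> t * D = (w t - 1) * P t"
    and w_deriv: "\<And>t. 0 \<le> t \<Longrightarrow> t < R \<Longrightarrow> (w has_real_derivative w' t) (at t)"
    and w'_cont: "continuous_on {0..<R} w'"
    and P_lim: "(P \<longlongrightarrow> 0) (at_left R)"
begin

lemma f_deriv:
  assumes "z \<in> ball 0 R"
  shows "(f has_field_derivative p z * W z) (at z)"
proof -
  obtain D where D: "(p has_field_derivative D) (at z)" "z * D = (W z - 1) * p z"
    using p_deriv[OF assms] by blast
  have "((\<lambda>z. z * p z) has_field_derivative p z * W z) (at z)"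
    by (rule derivative_eq_intros D refl)+ (use D(2) in \<open>simp add: algebra_simps\<close>)
  then show ?thesis
    by (rule has_field_derivative_transform_within_open[OF _ open_ball assms]) (simp add: f_eq)
qed

text \<open>The relation is multiplied by z because p' is known only through z p' = (W - 1) p. Both
  the convexity condition and the equation contain f'' only as z f''.\<close>

lemma f_deriv2:
  assumes "z \<in> ball 0 R"
  obtains D where "(deriv f has_field_derivative D) (at z)" "z * D = p z * ((W z)\<^sup>2 - W z + z * W' z)"
proof -
  obtain D where D: "(p has_field_derivative D) (at z)" "z * D = (W z - 1) * p z"
    using p_deriv[OF assms] by blast
  have "((\<lambda>z. p z * W z) has_field_derivative D * W z + W' z * p z) (at z)"
    by (intro DERIV_mult D W_deriv assms)
  then have "(deriv f has_field_derivative D * W z + W' z * p z) (at z)"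
    by (rule has_field_derivative_transform_within_open[OF _ open_ball assms])
       (auto intro!: DERIV_imp_deriv[symmetric] f_deriv)
  moreover have "z * (D * W z + W' z * p z) = (z * D) * W z + z * W' z * p z"
    by (simp add: algebra_simps)
  then have "z * (D * W z + W' z * p z) = p z * ((W z)\<^sup>2 - W z + z * W' z)"
    unfolding D(2) by (simp add: algebra_simps power2_eq_square)
  ultimately show thesis
    by (rule that)
qed

text \<open>Derivatives along the real axis agree with complex ones at real points. Both sides then
  contain the nonzero factor p(t), which cancels.\<close>

lemma convexity_equation_iff:
  assumes "0 \<le> t" "t < R"
  shows "convexity_equation \<alpha> f t \<longleftrightarrow> (w t)\<^sup>2 + t * w' t = \<alpha> * w t"
proof -
  define f' where "f' = (\<lambda>t. vector_derivative (\<lambda>s. f (of_real s)) (at t))"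
  have f': "f' s = deriv f (of_real s)" if "\<bar>s\<bar> < R" for s
    unfolding f'_def using that
    by (intro vector_derivative_of_real_right)
       (auto simp: field_differentiable_def intro!: exI f_deriv)
  have t: "of_real t \<in> ball (0::complex) R"
    using assms by simp
  obtain D where D: "(deriv f has_field_derivative D) (at (of_real t))"
      "of_real t * D = p (of_real t) * ((W (of_real t))\<^sup>2 - W (of_real t) + of_real t * W' (of_real t))"
    using f_deriv2[OF t] .
  have df: "deriv f (of_real t) = p (of_real t) * W (of_real t)"
    using f_deriv[OF t] by (rule DERIV_imp_deriv)
  have "((\<lambda>z. z * deriv f z) has_field_derivative deriv f (of_real t) + of_real t * D) (at (of_real t))"
    by (rule derivative_eq_intros D refl)+ simp
  then have "((\<lambda>s. of_real s * deriv f (of_real s)) has_vector_derivative deriv f (of_real t) + of_real t * D) (at t)"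
    by (rule has_vector_derivative_real_field)
  then have "((\<lambda>s. of_real s * f' s) has_vector_derivative deriv f (of_real t) + of_real t * D) (at t)"
    by (rule has_vector_derivative_transform_within_open[where S = "{-R<..<R}"]) (use assms in \<open>auto simp: f'\<close>)
  then have "convexity_equation \<alpha> f t \<longleftrightarrow> deriv f (of_real t) + of_real t * D = of_real \<alpha> * deriv f (of_real t)"
    unfolding convexity_equation_def f'_def[symmetric] Let_def using assms by (simp add: vector_derivative_at f')
  also have "\<dots> \<longleftrightarrow> p (of_real t) * ((W (of_real t))\<^sup>2 + of_real t * W' (of_real t)) = p (of_real t) * (of_real \<alpha> * W (of_real t))"
    unfolding D(2) df by (simp add: algebra_simps)
  also have "\<dots> \<longleftrightarrow> (W (of_real t))\<^sup>2 + of_real t * W' (of_real t) = of_real \<alpha> * W (of_real t)"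
    using p_nz[OF t] by simp
  also have "\<dots> \<longleftrightarrow> of_real ((w t)\<^sup>2 + t * w' t) = (of_real (\<alpha> * w t) :: complex)"
    using assms by (simp add: W_real W'_real)
  also have "\<dots> \<longleftrightarrow> (w t)\<^sup>2 + t * w' t = \<alpha> * w t"
    by (rule of_real_eq_iff)
  finally show ?thesis .
qed

lemma curvature_eq:
  assumes z: "z \<in> ball 0 R" and nz: "W z \<noteq> 0"
  shows "1 + z * deriv (deriv f) z / deriv f z = W z + z * W' z / W z"
proof -
  obtain D where D: "(deriv f has_field_derivative D) (at z)" "z * D = p z * ((W z)\<^sup>2 - W z + z * W' z)"
    using f_deriv2[OF z] .
  have "1 + z * deriv (deriv f) z / deriv f z = 1 + (z * D) / (p z * W z)"
    using f_deriv[OF z] D(1) by (simp add: DERIV_imp_deriv)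
  also have "\<dots> = W z + z * W' z / W z"
    unfolding D(2) using nz p_nz[OF z] by (simp add: field_simps power2_eq_square)
  finally show ?thesis .
qed

text \<open>Any disk larger than \<rho> contains the point \<rho>, where the real part equals
  \<alpha>, against the strict inequality. Inside the disk of radius \<rho>, the triangle inequality
  reduces everything to the real point |z|.\<close>

lemma radius_of_convexity_smallest_root:
  "is_smallest_positive_root \<delta> (convexity_equation \<alpha> f) (radius_of_convexity \<delta> \<alpha> f)"
proof -
  obtain \<rho> where \<rho>: "0 < \<rho>" "\<rho> < R" "\<And>t. 0 \<le> t \<Longrightarrow> t \<le> \<rho> \<Longrightarrow> 0 < w t"
    "(w \<rho>)\<^sup>2 + \<rho> * w' \<rho> = \<alpha> * w \<rho>"
    "\<And>t. 0 \<le> t \<Longrightarrow> t < \<rho> \<Longrightarrow> \<alpha> * w t < (w t)\<^sup>2 + t * w' t"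
    using convexity_root_exists[OF R(1) \<alpha> P_pos P_deriv w_deriv w'_cont P_lim] by blast
  have \<rho>_\<delta>: "ereal \<rho> < \<delta>"
    using \<rho>(2) R(2) by (meson ereal_less_le less_ereal.simps(1) order_less_le_trans)
  let ?S = "{ereal r | r. 0 < r \<and> ball (0::complex) r \<subseteq> eball 0 \<delta> \<and>
            (\<forall>z\<in>ball 0 r. deriv f z \<noteq> 0 \<and> Re (1 + z * deriv (deriv f) z / deriv f z) > \<alpha>)}"
  have "Sup ?S = ereal \<rho>"
  proof (rule antisym)
    show "Sup ?S \<le> ereal \<rho>"
    proof (rule Sup_least, safe)
      fix r assume r: "\<forall>z\<in>ball 0 r. deriv f z \<noteq> 0 \<and> Re (1 + z * deriv (deriv f) z / deriv f z) > \<alpha>"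
      show "ereal r \<le> ereal \<rho>"
      proof (rule ccontr)
        assume "\<not> ?thesis"
        then have "of_real \<rho> \<in> ball (0::complex) r"
          using \<rho>(1) by simp
        then have "\<alpha> < Re (1 + of_real \<rho> * deriv (deriv f) (of_real \<rho>) / deriv f (of_real \<rho>))"
          using r by blast
        also have "\<dots> = Re (of_real (w \<rho> + \<rho> * w' \<rho> / w \<rho>))"
          using \<rho>(1,2) \<rho>(3)[of \<rho>] curvature_eq[of "of_real \<rho>"] W_real[of \<rho>] W'_real[of \<rho>] by simp
        also have "\<dots> = w \<rho> + \<rho> * w' \<rho> / w \<rho>"
          by (rule Re_complex_of_real)
        also have "\<dots> = ((w \<rho>)\<^sup>2 + \<rho> * w' \<rho>) / w \<rho>"
          using \<rho>(1) \<rho>(3)[of \<rho>] by (simp add: field_simps power2_eq_square)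
        also have "\<dots> = \<alpha>"
          unfolding \<rho>(4) using \<rho>(1) \<rho>(3)[of \<rho>] by simp
        finally show False by simp
      qed
    qed
    have "\<alpha> < Re (1 + z * deriv (deriv f) z / deriv f z)" "deriv f z \<noteq> 0" if "z \<in> ball 0 \<rho>" for z
    proof -
      define r where "r = norm z"
      have r: "0 \<le> r" "r < \<rho>" "z \<in> ball 0 R"
        using that \<rho>(2) by (auto simp: r_def)
      have w: "0 < w r" "w r \<le> Re (W z)"
        using \<rho>(3)[of r] r W_Re[of z] by (auto simp: r_def)
      then have Wz: "w r \<le> norm (W z)" "W z \<noteq> 0"
        using complex_Re_le_cmod[of "W z"] by auto
      then show "deriv f z \<noteq> 0"
        using f_deriv[OF r(3)] p_nz[OF r(3)] by (simp add: DERIV_imp_deriv)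
      have "\<alpha> < ((w r)\<^sup>2 + r * w' r) / w r"
        using \<rho>(5)[OF r(1,2)] w(1) by (simp add: pos_less_divide_eq)
      also have "\<dots> = w r - (- (r * w' r)) / w r"
        using w(1) by (simp add: field_simps power2_eq_square)
      also have "\<dots> \<le> Re (W z) - norm (z * W' z / W z)"
      proof -
        \<comment> \<open>Passing from z to |z| enlarges the numerator and shrinks the denominator;
          \<open>W'_norm\<close> also yields the sign of -r w'.\<close>
        have "norm (z * W' z) / norm (W z) \<le> (- (r * w' r)) / w r"
          using W'_norm[OF r(3)] order_trans[OF norm_ge_zero W'_norm[OF r(3)]] w(1) Wz
          by (intro frac_le) (auto simp: r_def)
        then show ?thesis
          using w(2) by (simp add: norm_divide)
      qed
      also have "\<dots> \<le> Re (W z + z * W' z / W z)"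
        using complex_Re_le_cmod[of "- (z * W' z / W z)"] by simp
      finally show "\<alpha> < Re (1 + z * deriv (deriv f) z / deriv f z)"
        using curvature_eq[OF r(3) Wz(2)] by simp
    qed
    moreover have "ball (0::complex) \<rho> \<subseteq> eball 0 \<delta>"
      using \<rho>_\<delta> by (intro ball_eball_mono) simp
    ultimately show "ereal \<rho> \<le> Sup ?S"
      using \<rho>(1) by (intro Sup_upper) auto
  qed
  then have "radius_of_convexity \<delta> \<alpha> f = ereal \<rho>"
    by (simp add: radius_of_convexity_def)
  moreover have "convexity_equation \<alpha> f \<rho>"
    using \<rho>(1,2,4) by (simp add: convexity_equation_iff)
  moreover have "\<rho> \<le> s" if "0 < s" "convexity_equation \<alpha> f s" for s
  proof (rule ccontr)
    assume "\<not> \<rho> \<le> s"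
    then show False
      using that \<rho>(2) \<rho>(5)[of s] convexity_equation_iff[of s] by simp
  qed
  ultimately show ?thesis
    using \<rho>(1) \<rho>_\<delta> unfolding is_smallest_positive_root_def by blast
qed
end

lemma has_real_derivative_Re:
  assumes "(F has_field_derivative D) (at (of_real t))"
  shows "((\<lambda>t. Re (F (of_real t))) has_real_derivative Re D) (at t)"
  unfolding has_real_derivative_iff_has_vector_derivative
  by (intro bounded_linear.has_vector_derivative[OF bounded_linear_Re] has_vector_derivative_real_field assms)

section \<open>The convexity criterion for z times a power of the limit function\<close>

context pos_root_limit
begin

text \<open>Covers z \<Phi>(z^m)^a in all cases: (m, a) = (1, 1) for h, (2, 1) for g and (2,
  1/(\<gamma> + 1)) for f, with c = a m in W. The factor p enters only through its nonvanishing and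
  its logarithmic derivative, so a power branch can be used without naming its logarithm.\<close>

lemma convexity_setup:
  fixes f p :: "complex \<Rightarrow> complex" and R \<alpha> a :: real and m :: nat
  defines "lam \<equiv> R ^ m"
  assumes "0 < R" "ereal R \<le> \<delta>" "0 \<le> \<alpha>" "\<alpha> < 1" "0 < a" "0 < m"
    and lam: "\<Phi> (of_real lam) = 0" "\<And>t. 0 \<le> t \<Longrightarrow> t < lam \<Longrightarrow> \<Phi> (of_real t) \<noteq> 0"
    and f_eq: "\<And>z. z \<in> ball 0 R \<Longrightarrow> f z = z * p z"
    and p_nz: "\<And>z. z \<in> ball 0 R \<Longrightarrow> p z \<noteq> 0"
    and p_deriv: "\<And>z. z \<in> ball 0 R \<Longrightarrow> (p has_field_derivative
       of_real a * (of_nat m * z ^ (m - 1)) * logd \<Phi> (z ^ m) * p z) (at z)"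
  shows "is_smallest_positive_root \<delta> (convexity_equation \<alpha> f) (radius_of_convexity \<delta> \<alpha> f)"
proof -
  define c where "c = a * real m"
  define W where "W z = 1 + of_real c * (z ^ m * logd \<Phi> (z ^ m))" for z
  define W' where "W' z = of_real (c * m) * z ^ (m - 1) * (logd \<Phi> (z ^ m) + z ^ m * dlogd (z ^ m))" for z
  have c: "0 < c"
    using assms by (simp add: c_def)
  have zm: "z * z ^ (m - 1) = z ^ m" for z :: complex
    using \<open>0 < m\<close> by (cases m) auto
  have tm': "t * t ^ (m - 1) = t ^ m" for t :: real
    using \<open>0 < m\<close> by (cases m) auto
  have small: "norm (z ^ m) < lam" if "z \<in> ball 0 R" for z :: complex
    using that \<open>0 < m\<close> unfolding lam_def norm_power by (intro power_strict_mono) auto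
  have nz: "\<Phi> (of_real t) \<noteq> 0" if "0 \<le> t" "t \<le> norm (z ^ m)" "z \<in> ball 0 R" for t and z :: complex
    using lam(2) small that by fastforce
  have nz': "\<Phi> (z ^ m) \<noteq> 0" if "z \<in> ball 0 R" for z
    using nz[OF _ _ that] by (rule nonzero)
  have tm: "t ^ m < lam" if "0 \<le> t" "t < R" for t
    using that \<open>0 < m\<close> unfolding lam_def by (intro power_strict_mono) auto
  have W_deriv: "(W has_field_derivative W' z) (at z)" if "z \<in> ball 0 R" for z
  proof -
    have "((\<lambda>z. logd \<Phi> (z ^ m)) has_field_derivative dlogd (z ^ m) * (of_nat m * (1 * z ^ (m - Suc 0)))) (at z)"
      by (rule DERIV_chain2[OF logd_field_derivative[OF holomorphic[of UNIV]] DERIV_power[OF DERIV_ident]]) (use nz'[OF that] in auto)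
    from DERIV_mult[OF DERIV_power[OF DERIV_ident] this]
    have "((\<lambda>z. z ^ m * logd \<Phi> (z ^ m)) has_field_derivative
        of_nat m * z ^ (m - 1) * logd \<Phi> (z ^ m) + dlogd (z ^ m) * (of_nat m * z ^ (m - 1)) * z ^ m) (at z)"
      by (simp add: mult.assoc)
    from DERIV_add[OF DERIV_const[of 1] DERIV_cmult[OF this, of "of_real c"]]
    have "(W has_field_derivative 0 + of_real c * (of_nat m * z ^ (m - 1) * logd \<Phi> (z ^ m) +
        dlogd (z ^ m) * (of_nat m * z ^ (m - 1)) * z ^ m)) (at z)"
      by (simp only: W_def[abs_def])
    also have "0 + of_real c * (of_nat m * z ^ (m - 1) * logd \<Phi> (z ^ m) +
        dlogd (z ^ m) * (of_nat m * z ^ (m - 1)) * z ^ m) = W' z"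
      by (simp add: W'_def ring_distribs mult_ac)
    finally show ?thesis .
  qed
  have W'_eq: "W' z = deriv W z" if "z \<in> ball 0 R" for z
    using W_deriv[OF that] by (simp add: DERIV_imp_deriv)
  have zW': "z * W' z = of_real (c * m) * (z ^ m * (logd \<Phi> (z ^ m) + z ^ m * dlogd (z ^ m)))" for z
  proof -
    have "z * W' z = of_real (c * m) * ((z * z ^ (m - 1)) * (logd \<Phi> (z ^ m) + z ^ m * dlogd (z ^ m)))"
      by (simp add: W'_def mult_ac)
    then show ?thesis by (simp only: zm)
  qed
  have Phi_pos: "0 < Re (\<Phi> (of_real (t ^ m)))" if "0 \<le> t" "t < R" for t
    using that(1) tm[OF that] by (intro Re_pos lam(2)) (simp_all add: order_le_less_trans)
  have logd_real: "logd \<Phi> (of_real (t ^ m)) \<in> \<real>" "dlogd (of_real (t ^ m)) \<in> \<real>" if "0 \<le> t" "t < R" for t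
    using logd_Reals[of "t ^ m"] Phi_pos[OF that] by force+
  have W_real: "W (of_real t) = of_real (Re (W (of_real t)))" if "0 \<le> t" "t < R" for t
  proof -
    have "W (of_real t) \<in> \<real>"
      unfolding W_def using logd_real[OF that] by (intro Reals_add Reals_mult Reals_power) auto
    then show ?thesis by (simp add: of_real_Re)
  qed
  have W'_real: "W' (of_real t) = of_real (Re (W' (of_real t)))" if "0 \<le> t" "t < R" for t
  proof -
    have "W' (of_real t) \<in> \<real>"
      unfolding W'_def using logd_real[OF that] by (intro Reals_add Reals_mult Reals_power) auto
    then show ?thesis by (simp add: of_real_Re)
  qed
  \<comment> \<open>The assumptions fix p only up to a constant factor, so p need not be real on the
    real axis. P is a positive real function with the same logarithmic derivative there.\<close>
  define P where "P t = Re (\<Phi> (of_real (t ^ m))) powr a" for t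
  interpret convexity_setup f p W W' "\<lambda>t. Re (W (of_real t))" "\<lambda>t. Re (W' (of_real t))" P R \<alpha> \<delta>
  proof
    fix z assume z: "z \<in> ball (0::complex) R"
    show "\<exists>D. (p has_field_derivative D) (at z) \<and> z * D = (W z - 1) * p z"
    proof (intro exI conjI)
      show "(p has_field_derivative of_real a * (of_nat m * z ^ (m - 1)) * logd \<Phi> (z ^ m) * p z) (at z)"
        by (rule p_deriv[OF z])
      have "z * (of_real a * (of_nat m * z ^ (m - 1)) * logd \<Phi> (z ^ m) * p z) =
          of_real c * ((z * z ^ (m - 1)) * logd \<Phi> (z ^ m)) * p z"
        by (simp add: c_def mult_ac)
      then show "z * (of_real a * (of_nat m * z ^ (m - 1)) * logd \<Phi> (z ^ m) * p z) = (W z - 1) * p z"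
        by (simp only: zm W_def add_diff_cancel_left')
    qed
    have "(norm z) ^ m = norm (z ^ m)"
      by (simp add: norm_power)
    then have *: "complex_of_real (norm z) ^ m = of_real (norm (z ^ m))"
      by (metis of_real_power)
    show "Re (W (of_real (norm z))) \<le> Re (W z)"
      using logd_bounds(1)[OF nz[OF _ _ z]] c by (simp add: W_def *)
    have "norm (z * W' z) = c * m * (norm (z ^ m) * norm (logd \<Phi> (z ^ m) + z ^ m * dlogd (z ^ m)))"
      unfolding zW' using c by (simp only: norm_mult norm_of_real abs_of_pos) simp
    also have "\<dots> \<le> c * m * (norm (z ^ m) * - Re (logd \<Phi> (of_real (norm (z ^ m))) + of_real (norm (z ^ m)) * dlogd (of_real (norm (z ^ m)))))"
      using c by (intro mult_left_mono logd_bounds(2) nz[OF _ _ z]) auto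
    also have "\<dots> = - Re (of_real (norm z) * W' (of_real (norm z)))"
    proof -
      have "Re (of_real k * (of_real x * A)) = k * (x * Re A)" for k x A
        by simp
      then show ?thesis
        unfolding zW' * by (simp only: of_real_power[symmetric] mult_minus_right)
    qed
    finally show "norm (z * W' z) \<le> - norm z * Re (W' (of_real (norm z)))"
      by simp
  next
    fix t assume t: "0 \<le> t" "t < R"
    then have tb: "of_real t \<in> ball (0::complex) R"
      by simp
    show "0 < P t"
      using Phi_pos[OF t] by (simp add: P_def)
    show "((\<lambda>t. Re (W (of_real t))) has_real_derivative Re (W' (of_real t))) (at t)"
      by (intro has_real_derivative_Re W_deriv tb)
    define x where "x = t ^ m"
    have Px: "Re (\<Phi> (of_real x)) > 0" and real: "logd \<Phi> (of_real x) \<in> \<real>"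
      using Phi_pos[OF t] logd_real[OF t] by (simp_all add: x_def)
    have "((\<lambda>x. Re (\<Phi> (of_real x))) has_real_derivative Re (deriv \<Phi> (of_real x))) (at x)"
      using holomorphic[of UNIV] by (intro has_real_derivative_Re holomorphic_derivI) auto
    then have "(P has_real_derivative a * Re (\<Phi> (of_real x)) powr (a - 1) * (Re (deriv \<Phi> (of_real x)) * (of_nat m * t ^ (m - 1)))) (at t)"
      unfolding P_def[abs_def] x_def using Phi_pos[OF t]
      by (intro DERIV_chain2[where f = "\<lambda>x. x powr a"] DERIV_chain2[where f = "\<lambda>x. Re (\<Phi> (of_real x))"]
          has_real_derivative_powr) (auto intro!: derivative_eq_intros)
    moreover have "t * (a * Re (\<Phi> (of_real x)) powr (a - 1) * (Re (deriv \<Phi> (of_real x)) * (of_nat m * t ^ (m - 1))))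
       = (Re (W (of_real t)) - 1) * P t"
    proof -
      have "deriv \<Phi> (of_real x) = of_real (Re (logd \<Phi> (of_real x)) * Re (\<Phi> (of_real x)))"
        using Px real by (auto simp: of_real_Re logd_def)
      then have d: "Re (deriv \<Phi> (of_real x)) = Re (logd \<Phi> (of_real x)) * Re (\<Phi> (of_real x))"
        by (metis Re_complex_of_real)
      have "Re (W (of_real t)) - 1 = c * (x * Re (logd \<Phi> (of_real x)))"
        by (simp add: W_def x_def flip: of_real_power)
      moreover have "Re (\<Phi> (of_real x)) powr (a - 1) * Re (\<Phi> (of_real x)) = P t"
        using Px powr_add[of "Re (\<Phi> (of_real x))" "a - 1" 1] by (simp add: P_def x_def)
      ultimately show ?thesis
        using tm'[of t] unfolding d x_def[symmetric] c_def by (simp flip: x_def add: mult_ac) (metis mult.assoc mult.commute)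
    qed
    ultimately show "\<exists>D. (P has_real_derivative D) (at t) \<and> t * D = (Re (W (of_real t)) - 1) * P t"
      by blast
  next
    \<comment> \<open>Continuity of W' is read off from holomorphy of W, not from the
      formula.\<close>
    have "W holomorphic_on ball 0 R"
      unfolding holomorphic_on_def field_differentiable_def using W_deriv by (blast intro: DERIV_subset)
    then have "continuous_on (ball 0 R) W'"
      using holomorphic_on_imp_continuous_on[OF holomorphic_deriv[OF _ open_ball]] W'_eq
      by (metis (no_types, lifting) continuous_on_cong)
    then have "continuous_on {0..<R} (\<lambda>t. W' (of_real t))"
      by (rule continuous_on_compose2) (auto intro!: continuous_intros)
    then show "continuous_on {0..<R} (\<lambda>t. Re (W' (of_real t)))"
      by (rule bounded_linear.continuous_on[OF bounded_linear_Re])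
  next
    have "continuous_on UNIV (\<lambda>t. Re (\<Phi> (of_real (t ^ m))))"
      by (rule continuous_on_compose2[OF continuous_on_real[of UNIV]]) (auto intro!: continuous_intros)
    then have "((\<lambda>t. Re (\<Phi> (of_real (t ^ m)))) \<longlongrightarrow> Re (\<Phi> (of_real (R ^ m)))) (at_left R)"
      by (auto simp: continuous_on_def intro: tendsto_within_subset)
    moreover have "\<forall>\<^sub>F t in at_left R. 0 \<le> Re (\<Phi> (of_real (t ^ m)))"
      using \<open>0 < R\<close> Phi_pos by (intro eventually_at_leftI[of 0]) (auto intro!: less_imp_le)
    \<comment> \<open>The base tends to 0, so convergence of the power uses that the base is
      eventually nonnegative and that a > 0.\<close>
    ultimately have "(P \<longlongrightarrow> 0 powr a) (at_left R)"
      unfolding P_def[abs_def] using lam(1) \<open>0 < a\<close>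
      by (intro tendsto_powr' tendsto_const) (auto simp: lam_def)
    then show "(P \<longlongrightarrow> 0) (at_left R)" by simp
  qed (use assms W_deriv W_real W'_real in auto)
  show ?thesis
    by (rule radius_of_convexity_smallest_root)
qed

end

section \<open>Real-rooted approximations\<close>

text \<open>Both sides have degree at most n and agree at n + 1 distinct points: 0 and the n
  roots.\<close>

lemma poly_eq_prod_roots:
  fixes P :: "'a :: field poly"
  assumes "degree P \<le> n" "poly P 0 = 1" "inj_on r {..<n}"
    and "\<And>i. i < n \<Longrightarrow> r i \<noteq> 0 \<and> poly P (r i) = 0"
  shows "poly P x = (\<Prod>i<n. 1 - inverse (r i) * x)"
proof -
  define Q where "Q = (\<Prod>i<n. [:1, - inverse (r i):])"
  have "P = Q"
  proof (rule poly_eqI_degree)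
    show "poly P x = poly Q x" if "x \<in> insert 0 (r ` {..<n})" for x
    proof -
      have "poly Q (r i) = 0" if "i < n" for i
        using that assms(4) by (auto simp: Q_def poly_prod intro!: prod_zero bexI[of _ i])
      then show ?thesis
        using that assms by (auto simp: Q_def poly_prod)
    qed
    have "card (insert 0 (r ` {..<n})) = Suc n"
      using assms(3,4) by (subst card_insert_disjoint) (auto simp: card_image)
    moreover have "degree Q \<le> n"
    proof -
      have "degree Q \<le> (\<Sum>i<n. degree [:1, - inverse (r i):])"
        unfolding Q_def using degree_prod_sum_le[of "{..<n}" "\<lambda>i. [:1, - inverse (r i):]"] by (simp add: o_def)
      also have "\<dots> \<le> (\<Sum>i<n. 1)"
        by (intro sum_mono) simp
      finally show ?thesis by simp
    qed
    ultimately show "degree P < card (insert 0 (r ` {..<n}))" "degree Q < card (insert 0 (r ` {..<n}))"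
      using assms(1) by auto
  qed
  then show ?thesis
    by (simp add: Q_def poly_prod mult.commute)
qed

section \<open>Separated roots and q-difference operators\<close>

text \<open>The operator \<open>P \<mapsto> P(x) - c P(px)\<close> multiplies the coefficient of \<open>x\<^sup>k\<close> by \<open>1 - c p\<^sup>k\<close>. It keeps
  the roots positive as long as consecutive ones are separated by a factor of at least \<open>1/p\<close>.\<close>
definition separated_roots :: "real \<Rightarrow> nat \<Rightarrow> real poly \<Rightarrow> bool" where
  "separated_roots p n P \<longleftrightarrow> degree P \<le> n \<and> poly P 0 = 1 \<and>
     (\<exists>r. (\<forall>i<n. 0 < r i \<and> poly P (r i) = 0) \<and> (\<forall>i. Suc i < n \<longrightarrow> r i \<le> p * r (Suc i)))"

lemma separated_strict_mono:
  fixes r :: "nat \<Rightarrow> real"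
  assumes "0 < p" "p < 1" "\<And>i. i < n \<Longrightarrow> 0 < r i" "\<And>i. Suc i < n \<Longrightarrow> r i \<le> p * r (Suc i)"
    and "i < j" "j < n"
  shows "r i < r j"
  using assms(5,6)
proof (induction j)
  case (Suc j)
  have "r j \<le> p * r (Suc j)" "0 < r (Suc j)"
    using assms(3,4) Suc.prems by auto
  then have "r j < r (Suc j)"
    using mult_strict_right_mono[OF assms(2), of "r (Suc j)"] by linarith
  then show ?case
    using Suc by (cases "i = j") auto
qed simp

text \<open>Exactly the first j factors are flipped: they are nonpositive, the others
  nonnegative.\<close>

lemma sign_prod_roots:
  fixes r :: "nat \<Rightarrow> real"
  assumes "j \<le> n" "\<And>i. i < n \<Longrightarrow> 0 < r i" "\<And>i. i < j \<Longrightarrow> r i \<le> x" "\<And>i. j \<le> i \<Longrightarrow> i < n \<Longrightarrow> x \<le> r i"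
  shows "0 \<le> (-1) ^ j * (\<Prod>i<n. 1 - inverse (r i) * x)"
proof -
  have split: "(\<Prod>i<n. 1 - inverse (r i) * x) = (\<Prod>i<j. 1 - inverse (r i) * x) * (\<Prod>i\<in>{j..<n}. 1 - inverse (r i) * x)"
    using assms(1) by (subst prod.union_disjoint[symmetric]) (auto intro!: prod.cong)
  have flip: "(-1) ^ j * (\<Prod>i<j. 1 - inverse (r i) * x) = (\<Prod>i<j. inverse (r i) * x - 1)"
    using prod.distrib[of "\<lambda>_. -1" "\<lambda>i. 1 - inverse (r i) * x" "{..<j}"] by simp
  show ?thesis
    unfolding split mult.assoc[symmetric] flip using assms
    by (intro mult_nonneg_nonneg prod_nonneg) (auto simp: field_simps)
qed

text \<open>Each of the two terms of P(x) - c P(px) vanishes at one end of the interval from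
  r_(j-1)/p to r_j: the second at the left end, the first at the right end. By separation, p r_j and
  r_(j-1)/p both lie between r_(j-1) and r_j, so P has the same weak sign at both, and the minus
  sign makes Q change sign. The new roots satisfy s_j \<le> r_j \<le> p s_(j+1), which restores the
  separation.\<close>

lemma separated_roots_q_difference:
  assumes p: "0 < p" "p < 1" and c: "0 \<le> c" "c < 1" and P: "separated_roots p n P"
  obtains Q where "separated_roots p n Q" "\<And>k. coeff Q k = coeff P k * ((1 - c * p ^ k) / (1 - c))"
proof -
  define Q where "Q = smult (1 / (1 - c)) (P - smult c (pcompose P [:0, p:]))"
  have poly_Q: "poly Q x = (poly P x - c * poly P (p * x)) / (1 - c)" for x
    by (simp add: Q_def poly_pcompose mult.commute)
  have coeff_Q: "coeff Q k = coeff P k * ((1 - c * p ^ k) / (1 - c))" for k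
    using c by (simp add: Q_def coeff_pcompose_linear field_simps)
  obtain r where r: "\<And>i. i < n \<Longrightarrow> 0 < r i" "\<And>i. i < n \<Longrightarrow> poly P (r i) = 0" "\<And>i. Suc i < n \<Longrightarrow> r i \<le> p * r (Suc i)"
    and P0: "poly P 0 = 1" and degP: "degree P \<le> n"
    using P unfolding separated_roots_def by blast
  have mono: "r i < r j" if "i < j" "j < n" for i j
    using separated_strict_mono[of p n r i j] p r(1,3) that by blast
  have mono': "r i \<le> r j" if "i \<le> j" "j < n" for i j
    using mono[of i j] that by (cases "i = j") auto
  have P_eq: "poly P x = (\<Prod>i<n. 1 - inverse (r i) * x)" for x
  proof (rule poly_eq_prod_roots[OF degP P0])
    show "inj_on r {..<n}"
      using mono by (intro linorder_inj_onI') force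
  qed (use r in force)
  \<comment> \<open>For j = 0 there is no preceding root; the left end 0 works because Q(0) =
    1.\<close>
  define a where "a j = (case j of 0 \<Rightarrow> 0 | Suc i \<Rightarrow> r i / p)" for j
  have "\<exists>x. a j \<le> x \<and> x \<le> r j \<and> poly Q x = 0" if j: "j < n" for j
  proof -
    have aj: "0 \<le> a j" "a j \<le> r j"
      using r j p by (auto simp: a_def field_simps less_imp_le split: nat.splits)
    have "0 \<le> (-1) ^ j * poly P (p * r j)"
      unfolding P_eq
    proof (rule sign_prod_roots)
      fix i assume "i < j"
      then obtain k where k: "j = Suc k" "i \<le> k"
        by (cases j) auto
      have "r i \<le> r k"
        using mono'[of i k] k j by simp
      also have "\<dots> \<le> p * r j"
        using r(3)[of k] k j by simp
      finally show "r i \<le> p * r j" .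
    next
      fix i assume "j \<le> i" "i < n"
      then have "r j \<le> r i"
        using mono' by simp
      moreover have "p * r j \<le> 1 * r j"
        using p r(1)[OF j] by (intro mult_right_mono) auto
      ultimately show "p * r j \<le> r i" by simp
    qed (use j r in auto)
    from mult_nonneg_nonneg[OF c(1) this]
    have "0 \<le> c * ((-1) ^ j * poly P (p * r j)) / (1 - c)"
      using c by (intro divide_nonneg_pos) auto
    then have "(-1) ^ j * poly Q (r j) \<le> 0"
      using r(2)[OF j] by (simp add: poly_Q mult.left_commute)
    moreover have "0 \<le> (-1) ^ j * poly Q (a j)"
    proof (cases j)
      case 0
      then show ?thesis
        using P0 c by (simp add: a_def poly_Q)
    next
      case (Suc k)
      have "0 \<le> (-1) ^ j * poly P (a j)"
        unfolding P_eq
      proof (rule sign_prod_roots)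
        fix i assume "i < j"
        then have "r i \<le> r k"
          using mono'[of i k] j Suc by simp
        also have "\<dots> \<le> a j"
          using p r(1)[of k] j Suc by (simp add: a_def field_simps)
        finally show "r i \<le> a j" .
      next
        fix i assume "j \<le> i" "i < n"
        then show "a j \<le> r i"
          using aj mono'[of j i] by simp
      qed (use j r in auto)
      moreover have "poly P (p * a j) = 0"
        using r(2)[of k] j Suc p by (simp add: a_def)
      ultimately show ?thesis
        using c by (simp add: poly_Q)
    qed
    \<comment> \<open>Weak signs suffice: if the interval shrinks to a point, Q vanishes at that
      point.\<close>
    ultimately have "\<exists>x\<ge>a j. x \<le> r j \<and> (-1) ^ j * poly Q x = 0"
      using aj by (intro IVT2') (auto intro!: continuous_intros)
    then show ?thesis by auto
  qed
  then obtain s where s: "\<And>j. j < n \<Longrightarrow> a j \<le> s j \<and> s j \<le> r j \<and> poly Q (s j) = 0"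
    by metis
  have Q0: "poly Q 0 = 1"
    using P0 c by (simp add: poly_Q)
  have "0 < s j" if "j < n" for j
  proof -
    have "0 \<le> a j"
      using r(1)[of "j - 1"] that p by (auto simp: a_def less_imp_le split: nat.splits)
    moreover have "s j \<noteq> 0"
      using s[OF that] Q0 by auto
    ultimately show ?thesis
      using s[OF that] by auto
  qed
  moreover have "s j \<le> p * s (Suc j)" if "Suc j < n" for j
  proof -
    have "s j \<le> r j" "r j / p \<le> s (Suc j)"
      using s[of j] s[OF that] that by (auto simp: a_def)
    then show ?thesis
      using p by (simp add: field_simps)
  qed
  moreover have "degree Q \<le> n"
    using degP coeff_Q by (intro degree_le) (auto simp: coeff_eq_0)
  ultimately have "separated_roots p n Q"
    using s Q0 unfolding separated_roots_def by blast
  then show thesis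
    using coeff_Q by (rule that)
qed

text \<open>The roots form a geometric progression with ratio 1/p, the extreme case of
  separation.\<close>

lemma separated_roots_q_pochhammer:
  assumes p: "0 < p" "p < 1"
  shows "separated_roots p N (\<Prod>i<N. [:1, - (p ^ i):])"
  unfolding separated_roots_def
proof (intro conjI exI[of _ "\<lambda>i. inverse (p ^ i)"] allI impI)
  show "degree (\<Prod>i<N. [:1, - (p ^ i):]) \<le> N"
    using degree_prod_sum_le[of "{..<N}" "\<lambda>i. [:1, - (p ^ i):]"] p by simp
  show "poly (\<Prod>i<N. [:1, - (p ^ i):]) (inverse (p ^ i)) = 0" if "i < N" for i
    using p that by (auto simp: poly_prod intro!: prod_zero bexI[of _ i])
qed (use p in \<open>auto simp: poly_prod\<close>)

text \<open>The q-binomial theorem, with the Gaussian binomial written as a quotient of products.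
  For k > N the factor at j = N is 1 - p^0 = 0, so the formula holds for every k.\<close>

lemma coeff_q_pochhammer:
  fixes p :: real
  assumes p: "0 < p" "p < 1"
  shows "coeff (\<Prod>i<N. [:1, - (p ^ i):]) k =
    (-1) ^ k * p ^ (k * (k - 1) div 2) * (\<Prod>j<k. 1 - p ^ (N - j)) / (\<Prod>j<k. 1 - p ^ Suc j)"
proof (induction N arbitrary: k)
  case 0
  then show ?case by (cases k) (auto simp: prod.lessThan_Suc_shift)
next
  case (Suc N)
  show ?case
  proof (cases k)
    case 0
    then show ?thesis
      using Suc[of 0] by (simp add: mult.commute[of _ "[:1, _:]"] del: power_Suc)
  next
    case k: (Suc k')
    define A where "A = (\<Prod>j<k'. 1 - p ^ (N - j))"
    define D where "D = (\<Prod>j<k'. 1 - p ^ Suc j)"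
    define e where "e = (-1) ^ k' * p ^ (k' * (k' - 1) div 2)"
    have e: "(-1) ^ k * p ^ (k * (k - 1) div 2) = - (e * p ^ k')"
    proof -
      have "k * (k - 1) div 2 = k' * (k' - 1) div 2 + k'"
        unfolding k by (cases k') (auto simp: algebra_simps)
      then show ?thesis
        by (simp add: k e_def power_add)
    qed
    have nz: "1 - p ^ Suc j \<noteq> 0" for j
      using power_Suc_less_one[of p j] p by simp
    have D: "D \<noteq> 0"
      unfolding D_def using nz by auto
    \<comment> \<open>The Pascal rule for Gaussian binomials. If k' > N, truncated subtraction would
      spoil it, but then A already contains a zero factor.\<close>
    have key: "p ^ k' * (1 - p ^ Suc N) * A = p ^ k' * (A * (1 - p ^ (N - k'))) + p ^ N * A * (1 - p ^ Suc k')"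
    proof (cases "k' \<le> N")
      case True
      then have "p ^ N = p ^ k' * p ^ (N - k')"
        by (simp flip: power_add)
      then show ?thesis
        by (simp add: algebra_simps)
    next
      case False
      then have "A = 0"
        unfolding A_def by (intro prod_zero bexI[of _ N]) auto
      then show ?thesis by simp
    qed
    have "coeff (\<Prod>i<Suc N. [:1, - (p ^ i):]) k
        = coeff (\<Prod>i<N. [:1, - (p ^ i):]) (Suc k') - p ^ N * coeff (\<Prod>i<N. [:1, - (p ^ i):]) k'"
      by (simp add: mult.commute[of _ "[:1, _:]"] k)
    also have "\<dots> = - (e * p ^ k') * (A * (1 - p ^ (N - k'))) / (D * (1 - p ^ Suc k')) - p ^ N * (e * A / D)"
      unfolding Suc k[symmetric] e by (simp add: k A_def D_def e_def)
    also have "\<dots> = - e * (p ^ k' * (A * (1 - p ^ (N - k'))) + p ^ N * A * (1 - p ^ Suc k')) / (D * (1 - p ^ Suc k'))"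
      using D nz[of k'] by (simp add: divide_simps) (simp add: algebra_simps)
    also have "\<dots> = - (e * p ^ k') * ((1 - p ^ Suc N) * A) / (D * (1 - p ^ Suc k'))"
      unfolding key[symmetric] by (simp add: mult_ac)
    also have "\<dots> = (-1) ^ k * p ^ (k * (k - 1) div 2) * (\<Prod>j<k. 1 - p ^ (Suc N - j)) / (\<Prod>j<k. 1 - p ^ Suc j)"
      unfolding e[symmetric] unfolding k prod.lessThan_Suc_shift[of "\<lambda>j. 1 - p ^ (Suc N - j)"]
      by (simp add: A_def D_def)
    finally show ?thesis .
  qed
qed

section \<open>Kurtz's criterion for alternating polynomials\<close>

lemma alternating_sum_bounds:
  fixes u :: "nat \<Rightarrow> real"
  assumes "\<And>k. 0 \<le> u k" "\<And>k. u (Suc k) \<le> u k"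
  shows "0 \<le> (\<Sum>k<m. (-1) ^ k * u k) \<and> (\<Sum>k<m. (-1) ^ k * u k) \<le> u 0"
  using assms
proof (induction m arbitrary: u)
  case (Suc m)
  have "(\<Sum>k<Suc m. (-1) ^ k * u k) = u 0 - (\<Sum>k<m. (-1) ^ k * u (Suc k))"
    by (subst sum.lessThan_Suc_shift) (simp add: sum_negf)
  then show ?case
    using Suc.IH[of "\<lambda>k. u (Suc k)"] Suc.prems(1)[of 0] Suc.prems order_trans[OF _ Suc.prems(2)[of 0]] by auto
qed simp

text \<open>Kurtz's criterion: at \<open>x n = sqrt (a (n - 1) / a (n + 1))\<close> the \<open>n\<close>-th term exceeds the sum
  of its two equal neighbours, and the remaining terms alternate and decay away from \<open>n\<close>.\<close>
lemma kurtz_roots: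
  fixes a :: "nat \<Rightarrow> real"
  assumes a0: "a 0 = 1" and pos: "\<And>k. 0 < a k" and log_concave: "\<And>k. 4 * a k * a (Suc (Suc k)) < (a (Suc k))\<^sup>2"
  defines "P \<equiv> \<lambda>N x. \<Sum>k\<le>N. (-1) ^ k * a k * x ^ k"
  obtains r where "\<And>i. i < N \<Longrightarrow> 0 < r i \<and> P N (r i) = 0" "inj_on r {..<N}"
proof -
  define \<rho> where "\<rho> k = a (Suc k) / a k" for k
  have \<rho>_pos: "0 < \<rho> k" for k
    using pos by (simp add: \<rho>_def)
  have \<rho>_dec: "4 * \<rho> (Suc k) < \<rho> k" for k
    using log_concave[of k] pos[of k] pos[of "Suc k"] by (simp add: \<rho>_def divide_simps power2_eq_square mult_ac)
  have \<rho>_mono: "\<rho> j \<le> \<rho> i" if "i \<le> j" for i j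
  proof (rule lift_Suc_antimono_le[OF _ that])
    show "\<rho> (Suc k) \<le> \<rho> k" for k
      using \<rho>_dec[of k] \<rho>_pos[of "Suc k"] by linarith
  qed
  define x where "x n = (case n of 0 \<Rightarrow> 0 | Suc k \<Rightarrow> 1 / sqrt (\<rho> k * \<rho> (Suc k)))" for n
  have x_nonneg: "0 \<le> x n" for n
    using \<rho>_pos by (auto simp: x_def less_imp_le split: nat.splits)
  have x_mono: "x n < x (Suc n)" for n
  proof (cases n)
    case 0
    then show ?thesis using \<rho>_pos by (simp add: x_def)
  next
    case (Suc k)
    have "\<rho> (Suc (Suc k)) < \<rho> k"
      using \<rho>_dec[of k] \<rho>_dec[of "Suc k"] \<rho>_pos[of "Suc k"] \<rho>_pos[of "Suc (Suc k)"] by linarith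
    then have "\<rho> (Suc k) * \<rho> (Suc (Suc k)) < \<rho> k * \<rho> (Suc k)"
      using \<rho>_pos[of "Suc k"] by (simp add: mult.commute)
    then show ?thesis
      using \<rho>_pos by (simp add: x_def Suc frac_less2)
  qed
  have sign: "0 < (-1) ^ n * P N (x n)" if "n \<le> N" for n
  proof (cases n)
    case 0
    then show ?thesis
      using a0 by (simp add: P_def x_def power_0_left if_distrib[of "\<lambda>y. _ * y"] sum.delta cong: if_cong)
  next
    case n: (Suc m)
    define y where "y = x n"
    define t where "t k = a k * y ^ k" for k
    have y: "0 < y"
      using x_mono[of m] x_nonneg[of m] by (simp add: y_def n)
    have y2: "y\<^sup>2 * (\<rho> m * \<rho> n) = 1"
      using \<rho>_pos[of m] \<rho>_pos[of n] by (simp add: y_def x_def n power_divide)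
    have t_pos: "0 < t k" for k
      using pos y by (simp add: t_def)
    have t_Suc: "t (Suc k) = (\<rho> k * y) * t k" for k
      using pos[of k] by (simp add: t_def \<rho>_def)
    \<comment> \<open>A is the quotient of term n by its left neighbour, B that of its right
      neighbour by term n. From A B = 1 and A > 4 B follows A^2 > 4, so each neighbour is less than
      half of term n.\<close>
    define A where "A = \<rho> m * y"
    define B where "B = \<rho> n * y"
    have AB: "0 < A" "0 < B" "A * B = 1" "4 * B < A"
      using \<rho>_pos y y2 \<rho>_dec[of m] by (auto simp: A_def B_def n power2_eq_square mult_ac)
    have "2 < A"
    proof (rule ccontr)
      assume "\<not> 2 < A"
      then have "A * A \<le> 2 * 2"
        using AB by (intro mult_mono) auto
      moreover have "4 * (A * B) < A * A"
        using mult_strict_left_mono[OF AB(4,1)] by (simp add: mult.left_commute)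
      ultimately show False using AB by simp
    qed
    then have B: "B < 1/2"
      using AB mult_strict_right_mono[of 2 A B] by simp
    have dec: "t (Suc k) \<le> t k" if "n \<le> k" for k
    proof -
      have "\<rho> k * y \<le> B"
        using \<rho>_mono[OF that] y by (simp add: B_def)
      then show ?thesis
        using B t_pos[of k] by (simp add: t_Suc)
    qed
    have inc: "t k \<le> t (Suc k)" if "k \<le> m" for k
    proof -
      have "A \<le> \<rho> k * y"
        using \<rho>_mono[OF that] y by (simp add: A_def)
      then show ?thesis
        using \<open>2 < A\<close> t_pos[of k] by (simp add: t_Suc)
    qed
    have "t m < t n / 2"
      using \<open>2 < A\<close> t_pos[of m] t_Suc[of m] by (simp add: n A_def field_simps)
    moreover have "t (Suc n) < t n / 2"
      using B t_pos[of n] t_Suc[of n] by (simp add: B_def field_simps)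
    moreover have "(\<Sum>k<N - n. (-1) ^ k * t (Suc n + k)) \<le> t (Suc n)"
      using alternating_sum_bounds[of "\<lambda>k. t (Suc n + k)" "N - n"] t_pos dec by (simp add: less_imp_le)
    moreover have "(\<Sum>k<n. (-1) ^ k * t (m - k)) \<le> t m"
    proof -
      define u where "u k = (if k \<le> m then t (m - k) else 0)" for k
      have "u (Suc k) \<le> u k" for k
        using inc[of "m - Suc k"] t_pos by (auto simp: u_def less_imp_le Suc_diff_Suc)
      then have "(\<Sum>k<n. (-1) ^ k * u k) \<le> u 0"
        using alternating_sum_bounds[of u n] t_pos by (simp add: u_def less_imp_le)
      moreover have "(\<Sum>k<n. (-1) ^ k * u k) = (\<Sum>k<n. (-1) ^ k * t (m - k))"
        by (intro sum.cong) (auto simp: u_def n)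
      ultimately show ?thesis
        by (simp add: u_def)
    qed
    moreover have "(-1) ^ n * P N y = t n - (\<Sum>k<n. (-1) ^ k * t (m - k)) - (\<Sum>k<N - n. (-1) ^ k * t (Suc n + k))"
    proof -
      have "P N y = (\<Sum>k<Suc N. (-1) ^ k * t k)"
        by (simp add: P_def t_def lessThan_Suc_atMost mult.assoc)
      also have "{..<Suc N} = {..<n} \<union> ({n} \<union> {Suc n..<Suc N})"
        using that by auto
      also have "(\<Sum>k\<in>\<dots>. (-1) ^ k * t k) = (\<Sum>k<n. (-1) ^ k * t k) + ((-1) ^ n * t n + (\<Sum>k\<in>{Suc n..<Suc N}. (-1) ^ k * t k))"
        by (subst sum.union_disjoint, simp, simp, force, subst sum.union_disjoint) auto
      also have "(\<Sum>k<n. (-1) ^ k * t k) = (\<Sum>k<n. (-1) ^ (m - k) * t (m - k))"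
        by (subst sum.nat_diff_reindex[symmetric]) (simp add: n)
      also have "\<dots> = (-1) ^ m * (\<Sum>k<n. (-1) ^ k * t (m - k))"
        unfolding sum_distrib_left
      proof (intro sum.cong refl)
        fix k assume "k \<in> {..<n}"
        then have "m = (m - k) + k"
          by (simp add: n)
        then have "(-1) ^ m * (-1) ^ k = (-1) ^ (m - k) * ((-1) ^ k * (-1) ^ k :: real)"
          by (metis mult.assoc power_add)
        also have "(-1) ^ k * (-1) ^ k = (1 :: real)"
          by (simp flip: power_add)
        finally show "(-1) ^ (m - k) * t (m - k) = (-1) ^ m * ((-1) ^ k * t (m - k))"
          by (simp flip: mult.assoc)
      qed
      also have "(\<Sum>k\<in>{Suc n..<Suc N}. (-1) ^ k * t k) = (\<Sum>k<N - n. (-1) ^ (Suc n + k) * t (Suc n + k))"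
        using that by (intro sum.reindex_bij_witness[of _ "\<lambda>k. Suc n + k" "\<lambda>k. k - Suc n"]) auto
      also have "\<dots> = (-1) ^ Suc n * (\<Sum>k<N - n. (-1) ^ k * t (Suc n + k))"
        by (simp add: sum_distrib_left power_add mult.assoc sum_negf)
      finally have eq: "P N y = (-1) ^ m * (\<Sum>k<n. (-1) ^ k * t (m - k)) + ((-1) ^ n * t n + (-1) ^ Suc n * (\<Sum>k<N - n. (-1) ^ k * t (Suc n + k)))" .
      \<comment> \<open>Sign bookkeeping with a = (-1)^n, b = (-1)^m and c = (-1)^(n + 1), where n =
        m + 1.\<close>
      have aux: "a * (b * X + (a * T + c * Y)) = T - X - Y" if "a = - b" "c = b" "b * b = 1" for a b c X T Y :: real
        using that by algebra
      show ?thesis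
        unfolding eq by (rule aux) (simp_all add: n flip: power_add)
    qed
    ultimately show ?thesis
      by (simp add: y_def)
  qed
  have "\<exists>z. x n < z \<and> z < x (Suc n) \<and> P N z = 0" if "n < N" for n
  proof -
    have s: "0 < (-1) ^ n * P N (x n)" "(-1) ^ n * P N (x (Suc n)) < 0"
      using sign[of n] sign[of "Suc n"] that by auto
    have "\<exists>z\<ge>x n. z \<le> x (Suc n) \<and> (-1) ^ n * P N z = 0"
      using s x_mono[of n] unfolding P_def by (intro IVT2') (auto intro!: continuous_intros)
    then obtain z where z: "x n \<le> z" "z \<le> x (Suc n)" "P N z = 0"
      by auto
    \<comment> \<open>The strict signs keep the zero off both ends, so adjacent intervals give
      distinct roots.\<close>
    then have "x n \<noteq> z" "z \<noteq> x (Suc n)"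
      using s by auto
    with z show ?thesis
      by (metis order_le_neq_trans)
  qed
  then obtain r where r: "\<And>n. n < N \<Longrightarrow> x n < r n \<and> r n < x (Suc n) \<and> P N (r n) = 0"
    by metis
  have x_le: "x i \<le> x j" if "i \<le> j" for i j
    using less_imp_le[OF x_mono] that by (rule lift_Suc_mono_le)
  have "r i < r j" if "i < j" "j < N" for i j
    using r[of i] r[of j] x_le[of "Suc i" j] that by simp
  then have "inj_on r {..<N}"
    by (intro linorder_inj_onI') force
  moreover have "0 < r i \<and> P N (r i) = 0" if "i < N" for i
    using r[OF that] x_nonneg[of i] by auto
  ultimately show thesis
    using that by blast
qed

section \<open>Limits of polynomials obtained by damping coefficients\<close>

text \<open>On the disk the error is at most the sum of |\<phi>_k| (1 - \<theta>_(N,k)) R^k,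
  independently of x. Tannery's theorem sends it to 0, with |\<phi>_k| R^k as majorant.\<close>

lemma uniform_limit_powser_damped:
  fixes \<phi> :: "nat \<Rightarrow> real" and \<theta> :: "nat \<Rightarrow> nat \<Rightarrow> real"
  assumes summable: "summable (\<lambda>k. \<bar>\<phi> k\<bar> * R ^ k)" and "0 \<le> R"
    and \<theta>: "\<And>N k. 0 \<le> \<theta> N k" "\<And>N k. \<theta> N k \<le> 1" "\<And>k. (\<lambda>N. \<theta> N k) \<longlonglongrightarrow> 1"
  shows "uniform_limit (cball 0 R) (\<lambda>N x. \<Sum>k. of_real (\<phi> k * \<theta> N k) * x ^ k)
           (\<lambda>x::complex. \<Sum>k. of_real (\<phi> k) * x ^ k) sequentially"
proof (rule uniform_limitI)
  fix e :: real assume "0 < e"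
  have bound: "\<bar>\<phi> k\<bar> * (1 - \<theta> N k) * R ^ k \<le> \<bar>\<phi> k\<bar> * R ^ k" for N k
    using \<theta>(1,2)[of N k] \<open>0 \<le> R\<close> by (simp add: mult_right_le_one_le mult_right_mono)
  have "(\<lambda>N. \<Sum>k. \<bar>\<phi> k\<bar> * (1 - \<theta> N k) * R ^ k) \<longlonglongrightarrow> (\<Sum>k. \<bar>\<phi> k\<bar> * (1 - 1) * R ^ k)"
  proof (rule tannerys_theorem[THEN conjunct2, THEN conjunct2])
    show "(\<lambda>N. \<bar>\<phi> k\<bar> * (1 - \<theta> N k) * R ^ k) \<longlonglongrightarrow> \<bar>\<phi> k\<bar> * (1 - 1) * R ^ k" for k
      by (intro tendsto_intros \<theta>)
    show "\<forall>\<^sub>F (k, N) in at_top \<times>\<^sub>F sequentially. norm (\<bar>\<phi> k\<bar> * (1 - \<theta> N k) * R ^ k) \<le> \<bar>\<phi> k\<bar> * R ^ k"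
      using bound \<theta>(2) \<open>0 \<le> R\<close> by (intro always_eventually) (auto simp: abs_mult)
  qed (use summable in auto)
  then have "\<forall>\<^sub>F N in sequentially. (\<Sum>k. \<bar>\<phi> k\<bar> * (1 - \<theta> N k) * R ^ k) < e"
    using \<open>0 < e\<close> by (intro order_tendstoD(2)) simp
  then show "\<forall>\<^sub>F N in sequentially. \<forall>x::complex\<in>cball 0 R. dist (\<Sum>k. of_real (\<phi> k * \<theta> N k) * x ^ k) (\<Sum>k. of_real (\<phi> k) * x ^ k) < e"
  proof eventually_elim
    case (elim N)
    show ?case
    proof
      fix x :: complex assume x: "x \<in> cball 0 R"
      have le: "norm (of_real c * x ^ k) \<le> \<bar>c\<bar> * R ^ k" for c k
        using x by (auto simp: norm_mult norm_power intro!: mult_left_mono power_mono)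
      have s1: "summable (\<lambda>k. of_real (\<phi> k) * x ^ k)"
        by (rule summable_comparison_test'[OF summable le])
      have s2: "summable (\<lambda>k. of_real (\<phi> k * \<theta> N k) * x ^ k)"
      proof (rule summable_comparison_test'[OF summable])
        show "norm (of_real (\<phi> k * \<theta> N k) * x ^ k) \<le> \<bar>\<phi> k\<bar> * R ^ k" for k
          using order_trans[OF le[of "\<phi> k * \<theta> N k" k], of "\<bar>\<phi> k\<bar> * R ^ k"] \<theta>(1,2)[of N k] \<open>0 \<le> R\<close>
          by (simp add: abs_mult mult_right_mono mult_right_le_one_le)
      qed
      have s3: "summable (\<lambda>k. \<bar>\<phi> k\<bar> * (1 - \<theta> N k) * R ^ k)"
        by (rule summable_comparison_test'[OF summable]) (use bound \<theta>(2) \<open>0 \<le> R\<close> in \<open>auto simp: abs_mult\<close>)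
      have "(\<Sum>k. of_real (\<phi> k) * x ^ k) - (\<Sum>k. of_real (\<phi> k * \<theta> N k) * x ^ k)
          = (\<Sum>k. of_real (\<phi> k * (1 - \<theta> N k)) * x ^ k)"
        by (subst suminf_diff[OF s1 s2]) (simp add: algebra_simps)
      also have "norm \<dots> \<le> (\<Sum>k. \<bar>\<phi> k\<bar> * (1 - \<theta> N k) * R ^ k)"
      proof (rule norm_suminf_le[OF _ s3])
        show "norm (of_real (\<phi> k * (1 - \<theta> N k)) * x ^ k) \<le> \<bar>\<phi> k\<bar> * (1 - \<theta> N k) * R ^ k" for k
          using le[of "\<phi> k * (1 - \<theta> N k)" k] \<theta>(2)[of N k] by (simp add: abs_mult)
      qed
      finally show "dist (\<Sum>k. of_real (\<phi> k * \<theta> N k) * x ^ k) (\<Sum>k. of_real (\<phi> k) * x ^ k) < e"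
        using elim by (simp add: dist_norm norm_minus_commute)
    qed
  qed
qed

lemma poly_map_poly_of_real:
  "poly (map_poly of_real P) (x :: complex) = (\<Sum>k. of_real (coeff P k) * x ^ k)"
proof -
  have "(\<Sum>k. of_real (coeff P k) * x ^ k) = (\<Sum>k\<le>degree P. of_real (coeff P k) * x ^ k)"
    by (intro suminf_finite) (auto simp: coeff_eq_0)
  then show ?thesis
    by (simp add: poly_altdef degree_map_poly coeff_map_poly)
qed

text \<open>Common frame of both constructions: \<theta> is a cutoff at degree N for Kurtz's
  criterion, and a product of Pochhammer-type factors for the q-difference operators.\<close>

lemma pos_root_limitI:
  fixes \<phi> :: "nat \<Rightarrow> real" and \<theta> :: "nat \<Rightarrow> nat \<Rightarrow> real"
  assumes summable: "\<And>R. 0 \<le> R \<Longrightarrow> summable (\<lambda>k. \<bar>\<phi> k\<bar> * R ^ k)"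
    and \<theta>: "\<And>N k. 0 \<le> \<theta> N k" "\<And>N k. \<theta> N k \<le> 1" "\<And>k. (\<lambda>N. \<theta> N k) \<longlonglongrightarrow> 1"
    and P: "\<And>N. \<exists>P r. degree P \<le> N \<and> poly P 0 = 1 \<and> (\<forall>k. coeff P k = \<phi> k * \<theta> N k) \<and>
              inj_on r {..<N} \<and> (\<forall>i<N. 0 < r i \<and> poly P (r i) = 0)"
  obtains n \<mu> where "pos_root_limit (\<lambda>x. \<Sum>k. of_real (\<phi> k) * x ^ k) n \<mu>"
proof -
  obtain P r where P: "\<And>N. degree (P N) \<le> N" "\<And>N. poly (P N) 0 = 1"
      "\<And>N k. coeff (P N) k = \<phi> k * \<theta> N k" "\<And>N. inj_on (r N) {..<N}"
      "\<And>N i. i < N \<Longrightarrow> 0 < r N i \<and> poly (P N) (r N i) = 0"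
    using P by metis
  \<comment> \<open>The value 1 beyond the degree is a filler: the locale asks for positivity at
    every index.\<close>
  define \<mu> where "\<mu> N i = (if i < N then inverse (r N i) else 1)" for N i
  have prod: "(\<Prod>i<N. 1 - of_real (\<mu> N i) * x) = (\<Sum>k. of_real (\<phi> k * \<theta> N k) * x ^ k)" for N and x :: complex
  proof -
    have of_real: "poly (map_poly of_real (P N)) (of_real t :: complex) = of_real (poly (P N) t)" for t
      by (simp add: poly_altdef degree_map_poly coeff_map_poly)
    have "poly (map_poly of_real (P N)) x = (\<Prod>i<N. 1 - inverse (of_real (r N i)) * x)"
    proof (rule poly_eq_prod_roots)
      show "degree (map_poly complex_of_real (P N)) \<le> N"
        using P(1) by (simp add: degree_map_poly)
      show "poly (map_poly complex_of_real (P N)) 0 = 1"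
        using of_real[of 0] P(2) by simp
      show "inj_on (\<lambda>i. complex_of_real (r N i)) {..<N}"
        using P(4)[of N] by (simp add: inj_on_def)
      show "complex_of_real (r N i) \<noteq> 0 \<and> poly (map_poly of_real (P N)) (complex_of_real (r N i)) = 0" if "i < N" for i
        using P(5)[OF that] by (simp add: of_real)
    qed
    also have "\<dots> = (\<Prod>i<N. 1 - of_real (\<mu> N i) * x)"
      by (intro prod.cong) (auto simp: \<mu>_def)
    finally show ?thesis
      unfolding poly_map_poly_of_real P(3) by simp
  qed
  have "pos_root_limit (\<lambda>x. \<Sum>k. of_real (\<phi> k) * x ^ k) (\<lambda>N. N) \<mu>"
  proof
    show "0 < \<mu> N i" for N i
      using P(5)[of i N] by (simp add: \<mu>_def)
    show "uniform_limit (cball 0 R) (\<lambda>N x. \<Prod>i<N. 1 - of_real (\<mu> N i) * x) (\<lambda>x::complex. \<Sum>k. of_real (\<phi> k) * x ^ k) sequentially" for R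
      unfolding prod using uniform_limit_powser_damped[OF summable[of R] _ \<theta>]
      by (cases "0 \<le> R") (auto simp: uniform_limit_iff)
  qed
  then show thesis by (rule that)
qed

section \<open>Coefficients of the normalized series\<close>

text \<open>With Q = q^(\<gamma> + 1) and s = (\<sigma> (1 - q))^2 these are the unsigned
  coefficients of \<Phi>: the quotient of the q-gamma values at 2k + \<gamma> + 1 and \<gamma> + 1
  is (Q; q)_(2k) / (1 - q)^(2k).\<close>

definition q_coeff :: "real \<Rightarrow> real \<Rightarrow> real \<Rightarrow> nat \<Rightarrow> real" where
  "q_coeff q Q s k = s ^ k * q ^ (k * (k - 1)) / (\<Prod>j<2 * k. 1 - Q * q ^ j)"

lemma q_factor_pos:
  fixes q Q :: real
  assumes "0 < q" "q < 1" "0 < Q" "Q < 1"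
  shows "0 < 1 - Q * q ^ j" "1 - Q * q ^ j \<le> 1" "1 - Q \<le> 1 - Q * q ^ j"
proof -
  have "0 < q ^ j" "q ^ j \<le> 1"
    using assms by (auto intro: power_le_one)
  then have "Q * q ^ j \<le> Q * 1" "0 < Q * q ^ j"
    using assms by (intro mult_left_mono mult_pos_pos; simp)+
  then show "0 < 1 - Q * q ^ j" "1 - Q * q ^ j \<le> 1" "1 - Q \<le> 1 - Q * q ^ j"
    using assms by linarith+
qed

context
  fixes q Q s :: real
  assumes q: "0 < q" "q < 1" and Q: "0 < Q" "Q < 1" and s: "0 < s"
begin

lemma q_coeff_pos: "0 < q_coeff q Q s k"
  unfolding q_coeff_def using q s q_factor_pos[OF q Q] by (intro divide_pos_pos mult_pos_pos prod_pos) auto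

lemma q_coeff_Suc:
  "q_coeff q Q s (Suc k) = q_coeff q Q s k * (s * (q ^ 2) ^ k / ((1 - Q * q ^ (2 * k)) * (1 - Q * q ^ Suc (2 * k))))"
proof -
  have "Suc k * (Suc k - 1) = k * (k - 1) + 2 * k"
    by (cases k) auto
  then have "q ^ (Suc k * (Suc k - 1)) = q ^ (k * (k - 1)) * (q ^ 2) ^ k"
    by (simp only: power_add power_mult)
  moreover have "(\<Prod>j<2 * Suc k. 1 - Q * q ^ j)
      = (\<Prod>j<2 * k. 1 - Q * q ^ j) * ((1 - Q * q ^ (2 * k)) * (1 - Q * q ^ Suc (2 * k)))"
    by (simp add: mult.assoc del: power_Suc)
  ultimately show ?thesis
    unfolding q_coeff_def by (simp only: power_Suc[of s k] times_divide_times_eq mult_ac)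
qed

lemma summable_q_coeff:
  assumes "0 \<le> R"
  shows "summable (\<lambda>k. q_coeff q Q s k * R ^ k)"
proof -
  \<comment> \<open>This bounds the quotient of consecutive terms, each denominator factor being at
    least 1 - Q.\<close>
  have "(\<lambda>k. s / (1 - Q)\<^sup>2 * (q ^ 2) ^ k * R) \<longlonglongrightarrow> s / (1 - Q)\<^sup>2 * 0 * R"
    using q by (intro tendsto_intros LIMSEQ_realpow_zero) (auto simp: power_less_one_iff)
  then have "\<forall>\<^sub>F k in sequentially. s / (1 - Q)\<^sup>2 * (q ^ 2) ^ k * R < 1 / 2"
    by (intro order_tendstoD) auto
  then obtain K where K: "\<And>k. K \<le> k \<Longrightarrow> s / (1 - Q)\<^sup>2 * (q ^ 2) ^ k * R < 1 / 2"
    by (auto simp: eventually_sequentially)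
  show ?thesis
  proof (rule summable_ratio_test[where c = "1/2" and N = K])
    fix k assume k: "K \<le> k"
    have "(1 - Q)\<^sup>2 \<le> (1 - Q * q ^ (2 * k)) * (1 - Q * q ^ Suc (2 * k))"
      unfolding power2_eq_square using q_factor_pos[OF q Q] Q by (intro mult_mono) (auto simp: less_imp_le simp del: power_Suc)
    then have "s * (q ^ 2) ^ k / ((1 - Q * q ^ (2 * k)) * (1 - Q * q ^ Suc (2 * k))) \<le> s * (q ^ 2) ^ k / (1 - Q)\<^sup>2"
      using s q Q by (intro divide_left_mono mult_pos_pos q_factor_pos) (auto intro: mult_nonneg_nonneg less_imp_le)
    then have "s * (q ^ 2) ^ k / ((1 - Q * q ^ (2 * k)) * (1 - Q * q ^ Suc (2 * k))) * R \<le> s * (q ^ 2) ^ k / (1 - Q)\<^sup>2 * R"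
      using assms by (rule mult_right_mono)
    also have "\<dots> \<le> 1 / 2"
      using K[OF k] by simp
    finally have "q_coeff q Q s k * R ^ k * (s * (q ^ 2) ^ k / ((1 - Q * q ^ (2 * k)) * (1 - Q * q ^ Suc (2 * k))) * R)
        \<le> q_coeff q Q s k * R ^ k * (1 / 2)"
      using q_coeff_pos assms by (intro mult_left_mono) (auto simp: less_imp_le)
    then have "q_coeff q Q s (Suc k) * R ^ Suc k \<le> 1/2 * (q_coeff q Q s k * R ^ k)"
      unfolding q_coeff_Suc by (simp add: mult_ac)
    then show "norm (q_coeff q Q s (Suc k) * R ^ Suc k) \<le> 1/2 * norm (q_coeff q Q s k * R ^ k)"
      using q_coeff_pos[of k] q_coeff_pos[of "Suc k"] assms by (simp add: abs_mult)
  qed simp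
qed

text \<open>The factors 1 - Q q^j increase with j, so the quotients u_k of consecutive coefficients
  satisfy u_(k+1) \<le> q^2 u_k. Kurtz's condition then follows from 4 q^2 < 1.\<close>

lemma pos_root_limit_q_coeff_kurtz:
  assumes "q < 1 / 2"
  obtains n \<mu> where "pos_root_limit (\<lambda>x. \<Sum>k. of_real ((-1) ^ k * q_coeff q Q s k) * x ^ k) n \<mu>"
proof (rule pos_root_limitI[where \<theta> = "\<lambda>N k. if k \<le> N then 1 else 0"])
  show "summable (\<lambda>k. \<bar>(-1) ^ k * q_coeff q Q s k\<bar> * R ^ k)" if "0 \<le> R" for R
    using summable_q_coeff[OF that] q_coeff_pos by (simp add: abs_mult less_imp_le)
  show "(\<lambda>N. if k \<le> N then 1 else 0 :: real) \<longlonglongrightarrow> 1" for k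
    by (rule tendsto_eventually) (auto simp: eventually_sequentially)
  show "\<exists>P r. degree P \<le> N \<and> poly P 0 = 1 \<and>
      (\<forall>k. coeff P k = (-1) ^ k * q_coeff q Q s k * (if k \<le> N then 1 else 0)) \<and>
      inj_on r {..<N} \<and> (\<forall>i<N. 0 < r i \<and> poly P (r i) = 0)" for N
  proof -
    have lc: "4 * q_coeff q Q s k * q_coeff q Q s (Suc (Suc k)) < (q_coeff q Q s (Suc k))\<^sup>2" for k
    proof -
      define u where "u k = s * (q ^ 2) ^ k / ((1 - Q * q ^ (2 * k)) * (1 - Q * q ^ Suc (2 * k)))" for k
      have u_pos: "0 < u k" for k
        unfolding u_def using s q q_factor_pos[OF q Q]
        by (intro divide_pos_pos mult_pos_pos) (auto simp del: power_Suc)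
      define F where "F j = 1 - Q * q ^ j" for j
      have F: "0 < F j" "F j \<le> F (Suc (Suc j))" for j
      proof -
        have "q ^ Suc (Suc j) \<le> q ^ j"
          using q by (intro power_decreasing) auto
        then show "0 < F j" "F j \<le> F (Suc (Suc j))"
          using q_factor_pos(1)[OF q Q] Q by (simp_all only: F_def diff_left_mono mult_left_mono less_imp_le)
      qed
      have "s * (q ^ 2) ^ Suc k / (F (2 * Suc k) * F (Suc (2 * Suc k))) \<le> s * (q ^ 2) ^ Suc k / (F (2 * k) * F (Suc (2 * k)))"
        using F s q by (intro divide_left_mono mult_mono mult_pos_pos) (simp_all add: less_imp_le)
      then have "u (Suc k) \<le> s * (q ^ 2) ^ Suc k / ((1 - Q * q ^ (2 * k)) * (1 - Q * q ^ Suc (2 * k)))"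
        by (simp only: u_def F_def)
      also have "\<dots> = q ^ 2 * u k"
        by (simp add: u_def)
      finally have "4 * u (Suc k) \<le> (2 * q)\<^sup>2 * u k"
        by (simp add: power_mult_distrib)
      also have "\<dots> < 1 * u k"
      proof (rule mult_strict_right_mono[OF _ u_pos])
        show "(2 * q)\<^sup>2 < 1"
          using power_strict_mono[of "2 * q" 1 2] assms q by simp
      qed
      finally have "4 * u (Suc k) < u k" by simp
      then have "q_coeff q Q s k * q_coeff q Q s (Suc k) * (4 * u (Suc k)) < q_coeff q Q s k * q_coeff q Q s (Suc k) * u k"
        using q_coeff_pos by (intro mult_strict_left_mono mult_pos_pos)
      moreover have "q_coeff q Q s (Suc (Suc k)) = q_coeff q Q s (Suc k) * u (Suc k)" "q_coeff q Q s (Suc k) = q_coeff q Q s k * u k"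
        by (simp_all only: q_coeff_Suc u_def)
      ultimately show ?thesis
        by (simp add: power2_eq_square mult_ac)
    qed
    obtain r where r: "\<And>i. i < N \<Longrightarrow> 0 < r i \<and> (\<Sum>k\<le>N. (-1) ^ k * q_coeff q Q s k * r i ^ k) = 0" "inj_on r {..<N}"
      using kurtz_roots[of "q_coeff q Q s" N, OF _ q_coeff_pos lc] by (auto simp: q_coeff_def)
    define P where "P = (\<Sum>k\<le>N. monom ((-1) ^ k * q_coeff q Q s k) k)"
    have "coeff P k = (-1) ^ k * q_coeff q Q s k * (if k \<le> N then 1 else 0)" for k
      by (simp add: P_def coeff_sum)
    moreover have "poly P x = (\<Sum>k\<le>N. (-1) ^ k * q_coeff q Q s k * x ^ k)" for x
      by (simp add: P_def poly_sum poly_monom)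
    moreover have "degree P \<le> N"
      unfolding P_def by (intro degree_sum_le) (auto intro: order_trans[OF degree_monom_le])
    moreover have "poly P 0 = 1"
      unfolding poly_0_coeff_0 calculation(1) by (simp add: q_coeff_def)
    ultimately show ?thesis
      using r by (intro exI[of _ P] exI[of _ r]) auto
  qed
qed (use that in auto)

end

text \<open>The operators with c = b p^j, j < N, are applied to the product of the 1 - p^i x. The
  resulting multiplier of x^k telescopes to (b p^N; p)_k / (b; p)_k. Its numerator and the Gaussian
  factors 1 - p^(N - j) tend to 1; together they form \<theta>.\<close>

lemma pos_root_limit_q_coeff_wall:
  fixes p b s :: real
  assumes p: "0 < p" "p < 1" and b: "0 < b" "b < 1" and s: "0 < s"
    and \<phi>: "\<And>k. \<phi> k = (-1) ^ k * (s ^ k * p ^ (k * (k - 1) div 2) / ((\<Prod>j<k. 1 - p ^ Suc j) * (\<Prod>j<k. 1 - b * p ^ j)))"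
    and summable: "\<And>R. 0 \<le> R \<Longrightarrow> summable (\<lambda>k. \<bar>\<phi> k\<bar> * R ^ k)"
  obtains n \<mu> where "pos_root_limit (\<lambda>x. \<Sum>k. of_real (\<phi> k) * x ^ k) n \<mu>"
proof (rule pos_root_limitI[where \<theta> = "\<lambda>N k. (\<Prod>j<k. 1 - p ^ (N - j)) * (\<Prod>j<k. 1 - b * p ^ (j + N))", OF summable])
  fix N k
  have "0 \<le> 1 - p ^ j" "1 - p ^ j \<le> 1" for j
    using p by (auto intro: power_le_one)
  moreover have "0 \<le> 1 - b * p ^ j" "1 - b * p ^ j \<le> 1" for j
    using q_factor_pos(1,2)[OF p b, of j] by linarith+
  ultimately have "0 \<le> (\<Prod>j<k. 1 - p ^ (N - j))" "(\<Prod>j<k. 1 - p ^ (N - j)) \<le> 1"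
      "0 \<le> (\<Prod>j<k. 1 - b * p ^ (j + N))" "(\<Prod>j<k. 1 - b * p ^ (j + N)) \<le> 1"
    by (blast intro: prod_nonneg prod_le_1)+
  then show "0 \<le> (\<Prod>j<k. 1 - p ^ (N - j)) * (\<Prod>j<k. 1 - b * p ^ (j + N))"
      "(\<Prod>j<k. 1 - p ^ (N - j)) * (\<Prod>j<k. 1 - b * p ^ (j + N)) \<le> 1"
    by (auto intro: mult_le_one)
next
  fix k
  have lim: "(\<lambda>N. p ^ N) \<longlonglongrightarrow> 0"
    using p by (intro LIMSEQ_realpow_zero) auto
  have "(\<lambda>N. p ^ (N - j)) \<longlonglongrightarrow> 0" for j
    using LIMSEQ_offset[of "\<lambda>N. p ^ (N - j)" j] lim by simp
  moreover have "(\<lambda>N. p ^ (j + N)) \<longlonglongrightarrow> 0" for j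
    using LIMSEQ_ignore_initial_segment[OF lim, of j] by (simp add: add.commute)
  ultimately have "(\<lambda>N. (\<Prod>j<k. 1 - p ^ (N - j)) * (\<Prod>j<k. 1 - b * p ^ (j + N))) \<longlonglongrightarrow> (\<Prod>j<k. 1 - 0) * (\<Prod>j<k. 1 - b * 0)"
    by (intro tendsto_intros)
  then show "(\<lambda>N. (\<Prod>j<k. 1 - p ^ (N - j)) * (\<Prod>j<k. 1 - b * p ^ (j + N))) \<longlonglongrightarrow> 1"
    by simp
next
  fix N
  let ?P0 = "\<Prod>i<N. [:1, - (p ^ i):]"
  have "\<exists>P. separated_roots p N P \<and> (\<forall>k. coeff P k = coeff ?P0 k * (\<Prod>j<J. (1 - b * p ^ (j + k)) / (1 - b * p ^ j)))" for J
  proof (induction J)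
    case 0
    then show ?case
      using separated_roots_q_pochhammer[OF p] by auto
  next
    case (Suc J)
    then obtain P where P: "separated_roots p N P" "\<And>k. coeff P k = coeff ?P0 k * (\<Prod>j<J. (1 - b * p ^ (j + k)) / (1 - b * p ^ j))"
      by blast
    have "0 \<le> b * p ^ J" "b * p ^ J < 1"
      using p b q_factor_pos(1)[OF p b, of J] by auto
    then obtain P' where "separated_roots p N P'" "\<And>k. coeff P' k = coeff P k * ((1 - b * p ^ J * p ^ k) / (1 - b * p ^ J))"
      using separated_roots_q_difference[OF p _ _ P(1)] by blast
    then show ?case
      unfolding P(2) by (intro exI[of _ P']) (simp add: power_add mult.assoc)
  qed
  then obtain P where P: "separated_roots p N P"
    and coeff_P: "\<And>k. coeff P k = coeff ?P0 k * (\<Prod>j<N. (1 - b * p ^ (j + k)) / (1 - b * p ^ j))"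
    by blast
  have nz: "(\<Prod>j<k. 1 - b * p ^ j) \<noteq> 0" for k
    using q_factor_pos(1)[OF p b] by (simp add: less_imp_neq[symmetric])
  have shift: "(\<Prod>j<N. (1 - b * p ^ (j + k)) / (1 - b * p ^ j)) = (\<Prod>j<k. 1 - b * p ^ (j + N)) / (\<Prod>j<k. 1 - b * p ^ j)" for k
  proof -
    have split: "(\<Prod>j<k + N. 1 - b * p ^ j) = (\<Prod>j<k. 1 - b * p ^ j) * (\<Prod>j<N. 1 - b * p ^ (j + k))" for k N
      by (induction N) (simp_all add: add_ac)
    show ?thesis
      using split[of k N] split[of N k] nz by (simp add: prod_dividef frac_eq_eq add.commute mult.commute)
  qed
  obtain r where r: "\<And>i. i < N \<Longrightarrow> 0 < r i" "\<And>i. i < N \<Longrightarrow> poly P (r i) = 0" "\<And>i. Suc i < N \<Longrightarrow> r i \<le> p * r (Suc i)"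
      and P01: "poly P 0 = 1" "degree P \<le> N"
    using P unfolding separated_roots_def by blast
  have "inj_on r {..<N}"
    using separated_strict_mono[of p N r] p r by (intro linorder_inj_onI') force
  \<comment> \<open>Rescaling the variable supplies the factor s^k and divides all roots by
    s.\<close>
  define P' where "P' = pcompose P [:0, s:]"
  have "coeff P' k = \<phi> k * ((\<Prod>j<k. 1 - p ^ (N - j)) * (\<Prod>j<k. 1 - b * p ^ (j + N)))" for k
    unfolding P'_def coeff_pcompose_linear coeff_P shift coeff_q_pochhammer[OF p] \<phi> by simp
  moreover have "poly P' (r i / s) = 0" if "i < N" for i
    using r(2)[OF that] s by (simp add: P'_def poly_pcompose)
  moreover have "degree P' \<le> N" "poly P' 0 = 1"
    using P01 s by (simp_all add: P'_def poly_pcompose degree_pcompose)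
  ultimately show "\<exists>P r. degree P \<le> N \<and> poly P 0 = 1 \<and>
      (\<forall>k. coeff P k = \<phi> k * ((\<Prod>j<k. 1 - p ^ (N - j)) * (\<Prod>j<k. 1 - b * p ^ (j + N)))) \<and>
      inj_on r {..<N} \<and> (\<forall>i<N. 0 < r i \<and> poly P (r i) = 0)"
    using \<open>inj_on r {..<N}\<close> r(1) s by (intro exI[of _ P'] exI[of _ "\<lambda>i. r i / s"]) (auto simp: inj_on_def)
qed (use that in auto)

section \<open>The \<open>q\<close>-gamma function and the main theorem\<close>

lemma convergent_prod_qpoch:
  assumes "0 < q" "q < 1"
  shows "convergent_prod (\<lambda>k. 1 - a * complex_of_real q ^ k)"
proof (rule abs_convergent_prod_imp_convergent_prod)
  have "summable (\<lambda>k. norm a * q ^ k)"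
    using assms by (intro summable_mult summable_geometric) auto
  then show "abs_convergent_prod (\<lambda>k. 1 - a * complex_of_real q ^ k)"
    using assms by (simp add: abs_convergent_prod_conv_summable norm_mult norm_power)
qed

lemma qpoch_inf_of_real:
  assumes q: "0 < q" "q < 1" and a: "0 < a" "a < 1"
  shows "qpoch_inf (of_real a) q \<noteq> 0"
    and "qpoch_inf (of_real a) q = (1 - of_real a) * qpoch_inf (of_real (a * q)) q"
proof -
  note conv = convergent_prod_qpoch[OF q, of "of_real a"]
  have nz: "1 - of_real a * complex_of_real q ^ k \<noteq> 0" for k
    using q_factor_pos(1)[OF q a, of k] by (simp flip: of_real_power of_real_mult add: of_real_eq_1_iff)
  show "qpoch_inf (of_real a) q \<noteq> 0"
    unfolding qpoch_inf_def by (rule prodinf_nonzero[OF conv nz])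
  show "qpoch_inf (of_real a) q = (1 - of_real a) * qpoch_inf (of_real (a * q)) q"
    using prodinf_split_head[OF conv nz] nz[of 0] by (simp add: qpoch_inf_def field_simps)
qed

lemma powr_less_one_real:
  fixes q x :: real
  assumes "0 < q" "q < 1" "0 < x"
  shows "0 < q powr x" "q powr x < 1"
  using assms powr_less_mono2[of x q 1] by auto

lemma q_Gamma_eq:
  assumes q: "0 < q" "q < 1"
  shows "q_Gamma q (of_real x) = qpoch_inf (of_real q) q / qpoch_inf (of_real (q powr x)) q * of_real ((1 - q) powr (1 - x))"
proof -
  have "complex_of_real q powr of_real x = of_real (q powr x)"
    using q by (simp add: powr_of_real)
  moreover have "complex_of_real (1 - q) powr (1 - of_real x) = of_real ((1 - q) powr (1 - x))"
    using q powr_of_real[of "1 - q" "1 - x"] by simp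
  ultimately show ?thesis
    by (simp only: q_Gamma_def)
qed

lemma q_Gamma_nonzero:
  assumes q: "0 < q" "q < 1" and "0 < x"
  shows "q_Gamma q (of_real x) \<noteq> 0"
  unfolding q_Gamma_eq[OF q]
  using qpoch_inf_of_real(1)[OF q q] qpoch_inf_of_real(1)[OF q powr_less_one_real[OF q assms(3)]] q by simp

lemma q_Gamma_plus1:
  assumes q: "0 < q" "q < 1" and x: "0 < x"
  shows "q_Gamma q (of_real (x + 1)) * of_real (1 - q) = of_real (1 - q powr x) * q_Gamma q (of_real x)"
proof -
  define A where "A = qpoch_inf (of_real q) q"
  define B where "B = qpoch_inf (of_real (q powr (x + 1))) q"
  define C where "C = complex_of_real ((1 - q) powr (1 - (x + 1)))"
  have "q powr (x + 1) = q powr x * q"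
    using q by (simp add: powr_add)
  then have split: "qpoch_inf (of_real (q powr x)) q = of_real (1 - q powr x) * B"
    using qpoch_inf_of_real(2)[OF q powr_less_one_real[OF q x]] by (simp add: B_def)
  have B: "B \<noteq> 0"
    unfolding B_def using x by (intro qpoch_inf_of_real(1) q powr_less_one_real) auto
  have nz: "complex_of_real (1 - q powr x) \<noteq> 0"
    using powr_less_one_real[OF q x] by (simp only: of_real_eq_0_iff)
  have "(1 - q) powr (1 - x) = (1 - q) powr (1 - (x + 1)) * (1 - q)"
    using q powr_add[of "1 - q" "1 - (x + 1)" 1] by simp
  then have C: "complex_of_real ((1 - q) powr (1 - x)) = C * of_real (1 - q)"
    by (simp add: C_def)
  have "A / B * C * r = t * (A / (t * B) * (C * r))" if "t \<noteq> 0" for r t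
    using that B by (simp add: field_simps)
  from this[OF nz, of "of_real (1 - q)"] show ?thesis
    unfolding q_Gamma_eq[OF q] split C by (simp only: A_def B_def C_def)
qed

lemma q_Gamma_plus_nat:
  assumes q: "0 < q" "q < 1" and x: "0 < x"
  shows "q_Gamma q (of_real (x + real m)) * of_real (1 - q) ^ m =
    of_real (\<Prod>j<m. 1 - q powr x * q ^ j) * q_Gamma q (of_real x)"
proof (induction m)
  case (Suc m)
  have "q_Gamma q (of_real (x + real (Suc m))) * of_real (1 - q) ^ Suc m
      = (q_Gamma q (of_real (x + real m + 1)) * of_real (1 - q)) * of_real (1 - q) ^ m"
    by (simp add: add_ac mult_ac)
  also have "\<dots> = of_real (1 - q powr (x + real m)) * (q_Gamma q (of_real (x + real m)) * of_real (1 - q) ^ m)"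
    using x by (subst q_Gamma_plus1[OF q]) (auto simp: mult.assoc)
  also have "\<dots> = of_real (\<Prod>j<Suc m. 1 - q powr x * q ^ j) * q_Gamma q (of_real x)"
    unfolding Suc using q by (simp add: powr_add powr_realpow mult_ac)
  finally show ?case .
qed simp

lemma calE_eq:
  assumes q: "0 < q" "q < 1" and \<sigma>: "0 < \<sigma>" and \<gamma>: "0 \<le> \<gamma>"
  shows "q_Gamma q (of_real (\<gamma> + 1)) * calE \<gamma> \<sigma> q z =
    (\<Sum>k. of_real ((-1) ^ k * q_coeff q (q powr (\<gamma> + 1)) ((\<sigma> * (1 - q))\<^sup>2) k) * z ^ k)"
proof -
  define Q where "Q = q powr (\<gamma> + 1)"
  define s where "s = (\<sigma> * (1 - q))\<^sup>2"
  define G where "G = q_Gamma q (of_real (\<gamma> + 1))"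
  have Q: "0 < Q" "Q < 1"
    using powr_less_one_real[OF q, of "\<gamma> + 1"] \<gamma> by (auto simp: Q_def)
  have s: "0 < s"
    using \<sigma> q by (simp add: s_def)
  have G: "G \<noteq> 0"
    unfolding G_def using \<gamma> by (intro q_Gamma_nonzero q) auto
  have term_eq: "(-1) ^ n * of_real \<sigma> ^ (2 * n) * of_real q ^ (n * (n - 1)) / q_Gamma q (of_real (2 * real n + \<gamma> + 1)) * z ^ n
      = of_real ((-1) ^ n * q_coeff q Q s n) * z ^ n / G" for n
  proof -
    define D where "D = (\<Prod>j<2 * n. 1 - Q * q ^ j)"
    have "D \<noteq> 0"
      using q_factor_pos(1)[OF q Q] by (simp add: D_def less_imp_neq[symmetric])
    have "q_Gamma q (of_real (\<gamma> + 1 + real (2 * n))) * of_real (1 - q) ^ (2 * n) = of_real D * G"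
      unfolding D_def Q_def G_def using \<gamma> by (intro q_Gamma_plus_nat q) auto
    moreover define r where "r = 1 - q"
    ultimately have *: "q_Gamma q (of_real (2 * real n + \<gamma> + 1)) = of_real D * G / of_real r ^ (2 * n)"
      using q by (simp add: eq_divide_eq add_ac)
    have "r \<noteq> 0" "s ^ n = \<sigma> ^ (2 * n) * r ^ (2 * n)"
      using q by (simp_all add: r_def s_def power_mult power_mult_distrib)
    then show ?thesis
      unfolding * q_coeff_def D_def[symmetric] using G \<open>D \<noteq> 0\<close> by simp
  qed
  have "summable (\<lambda>k. of_real ((-1) ^ k * q_coeff q Q s k) * z ^ k)"
    by (rule summable_comparison_test'[OF summable_q_coeff[OF q Q s, of "norm z"]])
       (simp_all add: norm_mult norm_power q_coeff_pos[OF q Q s] less_imp_le)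
  then have "calE \<gamma> \<sigma> q z = (\<Sum>k. of_real ((-1) ^ k * q_coeff q Q s k) * z ^ k) / G"
    unfolding calE_def term_eq by (rule suminf_divide)
  then show ?thesis
    using G by (simp add: G_def Q_def s_def)
qed

text \<open>Splitting (Q; q)_(2k) into (Q; q^2)_k (Q q; q^2)_k exposes (q^2; q^2)_k: as the second
  factor for \<gamma> = 0, leaving b = q, and as the first for \<gamma> = 1, leaving b = q^3. In the
  remaining case two factors of the hypothesis are at most 1, so q < 1 - q. The inequality of
  coefficients is the input of \<open>zero_exists\<close>.\<close>

lemma pos_root_limit_q_series:
  assumes q: "0 < q" "q < 1" and s: "0 < s" and \<gamma>: "0 \<le> \<gamma>" "\<gamma> < 2"
    and cond: "\<gamma> \<in> {0, 1} \<or>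
         \<gamma> \<in> {0<..<2} - {1} \<and>
           inverse q * (1 - q) * (1 - q powr (\<gamma> + 1)) * (1 - q powr (\<gamma> + 2)) > 1"
  defines "Q \<equiv> q powr (\<gamma> + 1)"
  obtains n \<mu> where "pos_root_limit (\<lambda>x. \<Sum>k. of_real ((-1) ^ k * q_coeff q Q s k) * x ^ k) n \<mu>"
    "2 * q_coeff q Q s 2 \<noteq> (q_coeff q Q s 1)\<^sup>2"
proof -
  have Q: "0 < Q" "Q < 1"
    using powr_less_one_real[OF q, of "\<gamma> + 1"] \<gamma> by (auto simp: Q_def)
  have summable: "summable (\<lambda>k. \<bar>(-1) ^ k * q_coeff q Q s k\<bar> * R ^ k)" if "0 \<le> R" for R
    using summable_q_coeff[OF q Q s that] q_coeff_pos[OF q Q s] by (simp add: abs_mult less_imp_le)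
  have split: "(\<Prod>j<2 * k. 1 - Q * q ^ j) = (\<Prod>j<k. 1 - Q * (q ^ 2) ^ j) * (\<Prod>j<k. 1 - Q * q * (q ^ 2) ^ j)" for k
    by (induction k) (simp_all add: mult_ac flip: power_mult)
  have pw: "(q ^ 2) ^ (k * (k - 1) div 2) = q ^ (k * (k - 1))" for k
  proof -
    have "even (k * (k - 1))"
      by (cases k) auto
    then show ?thesis
      by (simp only: dvd_mult_div_cancel flip: power_mult)
  qed
  have p: "0 < q ^ 2" "q ^ 2 < 1"
    using q by (simp_all add: abs_square_less_1)
  have b: "0 < q ^ 3" "q ^ 3 < 1"
    using q by (simp_all add: power_less_one_iff)
  have pos: "0 < 1 - 2 * q\<^sup>2 + q\<^sup>2 * q\<^sup>2"
  proof -
    have "0 < (1 - q\<^sup>2)\<^sup>2"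
      using p by (simp add: power2_eq_square)
    also have "\<dots> = 1 - 2 * q\<^sup>2 + q\<^sup>2 * q\<^sup>2"
      by (simp add: power2_eq_square algebra_simps)
    finally show ?thesis .
  qed
  \<comment> \<open>The extra quantity equals (1 - Q q^2) - 2 q^2 (1 - Q). Its positivity, with 1 -
    Q q \<le> 1 - Q q^3, gives twice the second coefficient below the square of the first.\<close>
  have "(\<exists>n \<mu>. pos_root_limit (\<lambda>x. \<Sum>k. of_real ((-1) ^ k * q_coeff q Q s k) * x ^ k) n \<mu>)
      \<and> 0 < 1 - 2 * q\<^sup>2 + q\<^sup>2 * Q"
  proof -
    consider "\<gamma> = 0" | "\<gamma> = 1" | "inverse q * (1 - q) * (1 - Q) * (1 - q powr (\<gamma> + 2)) > 1"
      using cond by (auto simp: Q_def)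
    then show ?thesis
    proof cases
      case 1
      then have "Q = q"
        using q by (simp add: Q_def)
      have coeffs: "(-1) ^ k * q_coeff q Q s k = (-1) ^ k * (s ^ k * (q ^ 2) ^ (k * (k - 1) div 2) /
          ((\<Prod>j<k. 1 - (q ^ 2) ^ Suc j) * (\<Prod>j<k. 1 - q * (q ^ 2) ^ j)))" for k
      proof -
        have "(\<Prod>j<k. 1 - q * q * (q ^ 2) ^ j) = (\<Prod>j<k. 1 - (q ^ 2) ^ Suc j)"
          by (simp add: power2_eq_square)
        then show ?thesis
          unfolding q_coeff_def split pw unfolding \<open>Q = q\<close> by (simp only: mult.commute)
      qed
      have "\<exists>n \<mu>. pos_root_limit (\<lambda>x. \<Sum>k. of_real ((-1) ^ k * q_coeff q Q s k) * x ^ k) n \<mu>"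
        using pos_root_limit_q_coeff_wall[OF p q s coeffs summable] by blast
      moreover have "q\<^sup>2 * q\<^sup>2 \<le> q\<^sup>2 * Q"
        using q by (intro mult_left_mono) (auto simp: \<open>Q = q\<close> power2_eq_square)
      then have "0 < 1 - 2 * q\<^sup>2 + q\<^sup>2 * Q"
        using pos by linarith
      ultimately show ?thesis ..
    next
      case 2
      then have "Q = q\<^sup>2"
        using q by (simp add: Q_def powr_numeral)
      have coeffs: "(-1) ^ k * q_coeff q Q s k = (-1) ^ k * (s ^ k * (q ^ 2) ^ (k * (k - 1) div 2) /
          ((\<Prod>j<k. 1 - (q ^ 2) ^ Suc j) * (\<Prod>j<k. 1 - q ^ 3 * (q ^ 2) ^ j)))" for k
      proof -
        have "q\<^sup>2 * (q ^ 2) ^ j = (q ^ 2) ^ Suc j" "q\<^sup>2 * q = q ^ 3" for j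
          by (simp_all add: power3_eq_cube power2_eq_square)
        then show ?thesis
          unfolding q_coeff_def split pw unfolding \<open>Q = q\<^sup>2\<close> by (simp only:)
      qed
      have "\<exists>n \<mu>. pos_root_limit (\<lambda>x. \<Sum>k. of_real ((-1) ^ k * q_coeff q Q s k) * x ^ k) n \<mu>"
        using pos_root_limit_q_coeff_wall[OF p b s coeffs summable] by blast
      then show ?thesis
        using pos by (simp add: \<open>Q = q\<^sup>2\<close>)
    next
      case 3
      have "0 < q powr (\<gamma> + 2)" "q powr (\<gamma> + 2) < 1"
        using powr_less_one_real[OF q, of "\<gamma> + 2"] \<gamma> by auto
      then have "(1 - Q) * (1 - q powr (\<gamma> + 2)) \<le> 1 * 1"
        using Q by (intro mult_mono) auto
      then have "(1 - q) * ((1 - Q) * (1 - q powr (\<gamma> + 2))) \<le> (1 - q) * 1"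
        using q by (intro mult_left_mono) auto
      moreover have "q < (1 - q) * ((1 - Q) * (1 - q powr (\<gamma> + 2)))"
        using 3 q by (simp add: field_simps)
      ultimately have "q < 1 / 2" by simp
      moreover have "q * q < 1/2 * (1/2)"
        using calculation q by (intro mult_strict_mono) auto
      then have "0 < 1 - 2 * q\<^sup>2 + q\<^sup>2 * Q"
        using q Q by (simp add: power2_eq_square add_pos_pos)
      ultimately show ?thesis
        using pos_root_limit_q_coeff_kurtz[OF q Q s] by blast
    qed
  qed
  moreover have "2 * q_coeff q Q s 2 < (q_coeff q Q s 1)\<^sup>2" if *: "0 < 1 - 2 * q\<^sup>2 + q\<^sup>2 * Q"
  proof -
    define F where "F j = 1 - Q * q ^ j" for j
    have F: "0 < F j" for j
      using q_factor_pos(1)[OF q Q] by (simp add: F_def)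
    have c1: "q_coeff q Q s 1 = s / (F 0 * F 1)"
      by (simp add: q_coeff_def F_def numeral_2_eq_2)
    have "q_coeff q Q s (Suc 1) = q_coeff q Q s 1 * (s * q ^ 2 / (F 2 * F 3))"
      unfolding q_coeff_Suc[OF q Q s] by (simp add: F_def numeral_3_eq_3 numeral_2_eq_2)
    then have c2: "q_coeff q Q s 2 = q_coeff q Q s 1 * (s * q ^ 2 / (F 2 * F 3))"
      by (simp add: numeral_2_eq_2)
    have "2 * q\<^sup>2 * F 0 < F 2"
      using * by (simp add: F_def algebra_simps)
    moreover have "F 1 \<le> F 3"
      using q Q power_decreasing[of 1 3 q] by (simp add: F_def)
    ultimately have "(2 * q\<^sup>2 * F 0) * F 1 < F 2 * F 3"
      using F[of 0] F[of 1] q by (intro mult_less_le_imp_less) auto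
    then have "2 * (s * q ^ 2 / (F 2 * F 3)) < s / (F 0 * F 1)"
      using F s by (simp add: divide_simps mult_ac)
    then have "q_coeff q Q s 1 * (2 * (s * q ^ 2 / (F 2 * F 3))) < q_coeff q Q s 1 * q_coeff q Q s 1"
      unfolding c1[symmetric] using q_coeff_pos[OF q Q s, of 1] by (rule mult_strict_left_mono)
    then show ?thesis
      unfolding c2 power2_eq_square[of "q_coeff q Q s 1"] by (simp only: mult.left_commute)
  qed
  ultimately show thesis
    using that by (metis less_irrefl)
qed

text \<open>One logarithm is built only to show that the choice is not vacuous. The chosen p is then
  treated through its own L, for which exp L = F forces L' = F'/F.\<close>

lemma power_branch:
  assumes "0 < R" and F: "F holomorphic_on ball 0 R" "\<And>z. z \<in> ball 0 R \<Longrightarrow> F z \<noteq> 0" "F 0 = 1"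
    and z: "z \<in> ball 0 R"
  shows "power_branch (ball 0 R) F a z \<noteq> 0"
    and "(power_branch (ball 0 R) F a has_field_derivative
            of_real a * logd F z * power_branch (ball 0 R) F a z) (at z)"
proof -
  define p where "p = power_branch (ball 0 R) F a"
  obtain L0 where L0: "L0 holomorphic_on ball 0 R" "\<And>z. z \<in> ball 0 R \<Longrightarrow> exp (L0 z) = F z"
    using holomorphic_logarithm_exists[OF convex_ball open_ball F(1,2), of 0] \<open>0 < R\<close> by auto
  have "\<exists>p. p 0 = 1 \<and> (\<exists>L. L holomorphic_on ball 0 R \<and>
          (\<forall>z\<in>ball 0 R. exp (L z) = F z \<and> p z = exp (of_real a * L z)))"
  proof (intro exI conjI ballI)
    \<comment> \<open>Subtracting \<open>L0 0\<close> makes the power equal 1 at 0; the exponential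
      is unchanged because F 0 = 1.\<close>
    show "(\<lambda>z. L0 z - L0 0) holomorphic_on ball 0 R"
      by (intro holomorphic_intros L0)
    show "exp (L0 z - L0 0) = F z" if "z \<in> ball 0 R" for z
      using L0(2)[OF that] L0(2)[of 0] F(3) \<open>0 < R\<close> by (simp add: exp_diff)
    show "exp (of_real a * (L0 z - L0 0)) = exp (of_real a * (L0 z - L0 0))" for z ..
  qed simp
  then have "p 0 = 1 \<and> (\<exists>L. L holomorphic_on ball 0 R \<and>
          (\<forall>z\<in>ball 0 R. exp (L z) = F z \<and> p z = exp (of_real a * L z)))"
    unfolding p_def power_branch_def by (rule someI_ex)
  then obtain L where L: "L holomorphic_on ball 0 R" "\<And>z. z \<in> ball 0 R \<Longrightarrow> exp (L z) = F z"
      "\<And>z. z \<in> ball 0 R \<Longrightarrow> p z = exp (of_real a * L z)"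
    by blast
  have dL: "(L has_field_derivative deriv L z) (at z)"
    using L(1) z by (intro holomorphic_derivI) auto
  have "((\<lambda>z. exp (L z)) has_field_derivative exp (L z) * deriv L z) (at z)"
    by (rule DERIV_chain2[OF DERIV_exp dL])
  then have "(F has_field_derivative exp (L z) * deriv L z) (at z)"
    by (rule has_field_derivative_transform_within_open[OF _ open_ball z]) (simp add: L(2))
  then have "logd F z = deriv L z"
    using F(2)[OF z] L(2)[OF z] by (simp add: logd_def DERIV_imp_deriv)
  moreover have "((\<lambda>z. exp (of_real a * L z)) has_field_derivative exp (of_real a * L z) * (of_real a * deriv L z)) (at z)"
    by (rule DERIV_chain2[OF DERIV_exp DERIV_cmult[OF dL]])
  then have "(p has_field_derivative exp (of_real a * L z) * (of_real a * deriv L z)) (at z)"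
    by (rule has_field_derivative_transform_within_open[OF _ open_ball z]) (simp add: L(3))
  ultimately show "(power_branch (ball 0 R) F a has_field_derivative
            of_real a * logd F z * power_branch (ball 0 R) F a z) (at z)"
    using L(3)[OF z] by (simp add: p_def mult_ac)
  show "power_branch (ball 0 R) F a z \<noteq> 0"
    using L(3)[OF z] by (simp add: p_def)
qed

lemma deriv_powser_at_0:
  fixes c :: "nat \<Rightarrow> complex"
  assumes "\<And>y. summable (\<lambda>n. c n * y ^ n)"
  defines "F \<equiv> \<lambda>x. \<Sum>n. c n * x ^ n"
  shows "deriv F 0 = c 1" "deriv (deriv F) 0 = 2 * c 2"
proof -
  have d: "deriv F = (\<lambda>x. \<Sum>n. diffs c n * x ^ n)"
    unfolding F_def by (intro ext DERIV_imp_deriv termdiffs_strong_converges_everywhere assms)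
  have d2: "deriv (deriv F) = (\<lambda>x. \<Sum>n. diffs (diffs c) n * x ^ n)"
    unfolding d by (intro ext DERIV_imp_deriv termdiffs_strong_converges_everywhere termdiff_converges_all assms)
  show "deriv F 0 = c 1" "deriv (deriv F) 0 = 2 * c 2"
    unfolding d2 unfolding d by (simp_all add: diffs_def numeral_2_eq_2)
qed

theorem theorem1p3:
  fixes q \<sigma> \<gamma> \<alpha> :: real
  assumes "0 < q" "q < 1" and "0 < \<sigma>" and "0 \<le> \<gamma>" "\<gamma> < 2"
    and "\<gamma> \<in> {0, 1} \<or>
         \<gamma> \<in> {0<..<2} - {1} \<and>
           inverse q * (1 - q) * (1 - q powr (\<gamma> + 1)) * (1 - q powr (\<gamma> + 2)) > 1"
    and "0 \<le> \<alpha>" "\<alpha> < 1"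
  shows "is_smallest_positive_root (f_radius \<gamma> \<sigma> q) (convexity_equation \<alpha> (f_norm \<gamma> \<sigma> q))
           (radius_of_convexity (f_radius \<gamma> \<sigma> q) \<alpha> (f_norm \<gamma> \<sigma> q)) \<and>
         is_smallest_positive_root \<infinity> (convexity_equation \<alpha> (g_norm \<gamma> \<sigma> q))
           (radius_of_convexity \<infinity> \<alpha> (g_norm \<gamma> \<sigma> q)) \<and>
         is_smallest_positive_root \<infinity> (convexity_equation \<alpha> (h_norm \<gamma> \<sigma> q))
           (radius_of_convexity \<infinity> \<alpha> (h_norm \<gamma> \<sigma> q))"
proof -
  note q = assms(1,2) and \<alpha> = assms(7,8)
  define Q where "Q = q powr (\<gamma> + 1)"
  define s where "s = (\<sigma> * (1 - q))\<^sup>2"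
  define \<Phi> where "\<Phi> = (\<lambda>x::complex. \<Sum>k. of_real ((-1) ^ k * q_coeff q Q s k) * x ^ k)"
  have s: "0 < s"
    using assms by (simp add: s_def)
  have Q: "0 < Q" "Q < 1"
    using powr_less_one_real[OF q, of "\<gamma> + 1"] assms(4) by (auto simp: Q_def)
  have calE: "q_Gamma q (of_real (\<gamma> + 1)) * calE \<gamma> \<sigma> q z = \<Phi> z" for z
    unfolding \<Phi>_def Q_def s_def by (intro calE_eq assms)
  obtain n \<mu> where limit: "pos_root_limit \<Phi> n \<mu>" and ne: "2 * q_coeff q Q s 2 \<noteq> (q_coeff q Q s 1)\<^sup>2"
    using pos_root_limit_q_series[OF q s assms(4-6)] unfolding \<Phi>_def Q_def by blast
  interpret pos_root_limit \<Phi> n \<mu>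
    by (fact limit)
  have "deriv (deriv \<Phi>) 0 \<noteq> (deriv \<Phi> 0)\<^sup>2"
  proof -
    have "summable (\<lambda>k. of_real ((-1) ^ k * q_coeff q Q s k) * z ^ k)" for z :: complex
      by (rule summable_comparison_test'[OF summable_q_coeff[OF q Q s, of "norm z"]])
         (simp_all add: norm_mult norm_power q_coeff_pos[OF q Q s] less_imp_le)
    note deriv_powser_at_0[OF this, folded \<Phi>_def]
    then have "deriv (deriv \<Phi>) 0 = of_real (2 * q_coeff q Q s 2)" "(deriv \<Phi> 0)\<^sup>2 = of_real ((q_coeff q Q s 1)\<^sup>2)"
      by simp_all
    then show ?thesis
      using ne by (metis of_real_eq_iff)
  qed
  then obtain b where b: "0 < b" "\<Phi> (of_real b) = 0"
    using zero_exists by blast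
  obtain l where "0 < l" "l \<le> b" "Re (\<Phi> (of_real l)) = 0" and pos: "\<And>t. 0 \<le> t \<Longrightarrow> t < l \<Longrightarrow> 0 < Re (\<Phi> (of_real t))"
    using first_zero_exists[OF continuous_on_real[of "{0..b}"]] b by auto
  then have l: "0 < l" "\<Phi> (of_real l) = 0"
    using of_real_Re_at[of l] by auto
  have nz: "\<Phi> (of_real t) \<noteq> 0" if "0 \<le> t" "t < l" for t
    using pos[OF that] by auto
  have nz': "\<Phi> z \<noteq> 0" if "norm z < l" for z
    using that by (intro nonzero[of z] nz) auto
  have \<Phi>_deriv: "(\<Phi> has_field_derivative deriv \<Phi> z) (at z)" for z
    using holomorphic[of UNIV] by (intro holomorphic_derivI) auto
  have \<Phi>_sq: "((\<lambda>z. \<Phi> (z ^ 2)) has_field_derivative deriv \<Phi> (z ^ 2) * (2 * z)) (at z)" for z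
    by (rule DERIV_chain2[OF \<Phi>_deriv]) (auto intro!: derivative_eq_intros)
  define R where "R = sqrt l"
  have R: "0 < R" "R ^ 2 = l"
    using l by (simp_all add: R_def)
  have sq: "norm (z ^ 2) < l" if "z \<in> ball 0 R" for z :: complex
    using that power_strict_mono[of "norm z" R 2] R by (simp add: norm_power)
  have "is_smallest_positive_root \<infinity> (convexity_equation \<alpha> (h_norm \<gamma> \<sigma> q)) (radius_of_convexity \<infinity> \<alpha> (h_norm \<gamma> \<sigma> q))"
  proof (rule convexity_setup[where R = l and m = 1 and a = 1 and p = \<Phi>])
    show "h_norm \<gamma> \<sigma> q z = z * \<Phi> z" for z
      unfolding h_norm_def calE[symmetric] by (simp add: mult.assoc)
    show "(\<Phi> has_field_derivative of_real 1 * (of_nat 1 * z ^ (1 - 1)) * logd \<Phi> (z ^ 1) * \<Phi> z) (at z)" if "z \<in> ball 0 l" for z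
      using \<Phi>_deriv[of z] nz'[of z] that by (simp add: logd_def)
  qed (use l nz nz' \<alpha> in auto)
  moreover have "is_smallest_positive_root \<infinity> (convexity_equation \<alpha> (g_norm \<gamma> \<sigma> q)) (radius_of_convexity \<infinity> \<alpha> (g_norm \<gamma> \<sigma> q))"
  proof (rule convexity_setup[where R = R and m = 2 and a = 1 and p = "\<lambda>z. \<Phi> (z ^ 2)"])
    show "g_norm \<gamma> \<sigma> q z = z * \<Phi> (z ^ 2)" for z
      unfolding g_norm_def calE[symmetric] by (simp add: mult.assoc)
    show "((\<lambda>z. \<Phi> (z ^ 2)) has_field_derivative of_real 1 * (of_nat 2 * z ^ (2 - 1)) * logd \<Phi> (z ^ 2) * \<Phi> (z ^ 2)) (at z)"
      if "z \<in> ball 0 R" for z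
      using \<Phi>_sq[of z] nz'[OF sq[OF that]] by (simp add: logd_def mult_ac)
  qed (use R l nz nz' sq \<alpha> in auto)
  moreover have "is_smallest_positive_root (f_radius \<gamma> \<sigma> q) (convexity_equation \<alpha> (f_norm \<gamma> \<sigma> q))
           (radius_of_convexity (f_radius \<gamma> \<sigma> q) \<alpha> (f_norm \<gamma> \<sigma> q))"
  proof -
    have G: "q_Gamma q (of_real (\<gamma> + 1)) \<noteq> 0"
      using assms(4) by (intro q_Gamma_nonzero q) auto
    have calE_0: "calE \<gamma> \<sigma> q z = 0 \<longleftrightarrow> \<Phi> z = 0" for z
      using calE[of z] G by auto
    \<comment> \<open>For f the domain ends exactly at R, since z = R is itself a zero; the bound
      \<open>ereal R \<le> \<delta>\<close> of \<open>convexity_setup\<close> thus holds with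
      equality.\<close>
    have f_radius: "f_radius \<gamma> \<sigma> q = ereal R"
      unfolding f_radius_def zero_free_radius_def
    proof (rule antisym)
      show "Sup {ereal r |r. 0 < r \<and> (\<forall>z\<in>ball 0 r. calE \<gamma> \<sigma> q (z\<^sup>2) \<noteq> 0)} \<le> ereal R"
      proof (rule Sup_least, safe)
        fix r assume r: "\<forall>z\<in>ball 0 r. calE \<gamma> \<sigma> q (z\<^sup>2) \<noteq> 0"
        have "of_real R \<notin> ball (0::complex) r"
        proof
          assume "of_real R \<in> ball (0::complex) r"
          then have "\<Phi> (of_real R ^ 2) \<noteq> 0"
            using r by (simp add: calE_0)
          then show False
            using l(2) R(2) by (simp flip: of_real_power)
        qed
        then show "ereal r \<le> ereal R"
          using R by simp
      qed
      show "ereal R \<le> Sup {ereal r |r. 0 < r \<and> (\<forall>z\<in>ball 0 r. calE \<gamma> \<sigma> q (z\<^sup>2) \<noteq> 0)}"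
        using R(1) nz' sq by (intro Sup_upper) (auto simp: calE_0)
    qed
    define a where "a = 1 / (\<gamma> + 1)"
    define p where "p = power_branch (ball 0 R) (\<lambda>z. \<Phi> (z ^ 2)) a"
    have hol: "(\<lambda>z. \<Phi> (z ^ 2)) holomorphic_on ball 0 R"
      unfolding holomorphic_on_def field_differentiable_def using \<Phi>_sq DERIV_subset by blast
    note branch = power_branch[OF R(1) hol, of _ a, folded p_def]
    have "f_norm \<gamma> \<sigma> q z = z * p z" for z
      by (simp only: f_norm_def f_radius eball_ereal calE p_def a_def)
    moreover have "(p has_field_derivative of_real a * (of_nat 2 * z ^ (2 - 1)) * logd \<Phi> (z ^ 2) * p z) (at z)"
      if "z \<in> ball 0 R" for z
    proof -
      have "logd (\<lambda>z. \<Phi> (z ^ 2)) z = of_nat 2 * z ^ (2 - 1) * logd \<Phi> (z ^ 2)"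
        using DERIV_imp_deriv[OF \<Phi>_sq[of z]] by (simp add: logd_def)
      then show ?thesis
        using branch(2)[OF _ _ that] nz' sq by (simp add: mult.assoc)
    qed
    ultimately show ?thesis
      unfolding f_radius using R l nz branch(1) nz' sq \<alpha> assms(4)
      by (intro convexity_setup[where R = R and m = 2 and a = a and p = p]) (auto simp: a_def)
  qed
  ultimately show ?thesis
    by blast
qed

end
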